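(* Let $X$ be a finite set of $m$ alternatives, let $c_0$ be any choice function on $P_+(X)$ and let $\delta \in (0,1)$. Then there exist a probability distribution $\nu = \nu(c_0)$ on the set of linear orders of $X$ and a number $N = N(\delta,m)$ such that the following holds: for every $n > N$ and every social choice function $F$ on $n$ individuals satisfying (U), (IRA), (P), (N1'), (A2') and (M'), if $\pi_1,\dots,\pi_n$ are chosen independently according to $\nu$, then with probability at least $\delta$ it holds that $F(\pi_1,\dots,\pi_n)(S) = c_0(S)$ for all $S \in P_+(X)$.
   Context: $P_+(X)$ is the family of nonempty subsets of $X$. A choice function is a map $c : P_+(X) \to X$ with $c(S) \in S$ for all $S$. A linear order $\pi$ on $X$ determines the rational choice function $c_\pi$, where $c_\pi(S)$ is the $\pi$-maximal element of $S$. A social choice function on $n$ individuals assigns to each profile $(\pi_1,\dots,\pi_n)$ of linear orders a choice function $F(\pi_1,\dots,\pi_n)$; write $c_i = c_{\pi_i}$. Conditions: (U) $F$ is defined on all profiles of linear orders. (IRA) For each $S$ there is a function $F_S : S^n \to S$ with $F(\pi_1,\dots,\pi_n)(S) = F_S(c_1(S),\dots,c_n(S))$. (P) $F(\pi_1,\dots,\pi_n)(S) \in \{c_1(S),\dots,c_n(S)\}$. (N1') Neutrality: the social choice is invariant under permutations of the alternatives, i.e. for every permutation $\sigma$ of $X$, $F(\sigma\pi_1,\dots,\sigma\pi_n)(\sigma(S)) = \sigma(F(\pi_1,\dots,\pi_n)(S))$, where $\sigma\pi$ is the order transported by $\sigma$. (A2') Weak anonymity: there is a transitive group $\Sigma$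 of permutations of $\{1,\dots,n\}$ with $F(\pi_{\tau(1)},\dots,\pi_{\tau(n)}) = F(\pi_1,\dots,\pi_n)$ for all $\tau \in \Sigma$. (M') Monotonicity: if $F_S(x) = s$ and $x_i = t \ne s$, then changing $x_i$ from $t$ to $s$ leaves the value of $F_S$ equal to $s$. *)

theory Defs
  imports "HOL-Probability.Product_PMF" "HOL-Algebra.Sym_Groups"
begin

definition nonempty_subsets :: "'a set \<Rightarrow> 'a set set" where
  "nonempty_subsets X = {S. S \<subseteq> X \<and> S \<noteq> {}}"

(* Choice functions are total in HOL; only their values on nonempty_subsets X carry meaning. *)
definition choice_function :: "'a set \<Rightarrow> ('a set \<Rightarrow> 'a) \<Rightarrow> bool" where
  "choice_function X c \<longleftrightarrow> (\<forall>S\<in>nonempty_subsets X. c S \<in> S)"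

definition linear_orders :: "'a set \<Rightarrow> 'a rel set" where
  "linear_orders X = {\<pi>. linear_order_on X \<pi>}"

(* (y, x) \<in> \<pi> reads "y is below or equal to x", so the chosen x is the \<pi>-maximal element of S. *)
definition rational_choice :: "'a rel \<Rightarrow> 'a set \<Rightarrow> 'a" where
  "rational_choice \<pi> S = (THE x. x \<in> S \<and> (\<forall>y\<in>S. (y, x) \<in> \<pi>))"

(* Individuals are {1..n}; profiles take the value undefined outside {1..n}. *)
definition profiles :: "nat \<Rightarrow> 'a set \<Rightarrow> (nat \<Rightarrow> 'a rel) set" where
  "profiles n X = (\<Pi>\<^sub>E i\<in>{1..n}. linear_orders X)"

(* Includes condition (U): the domain is the set of all profiles of linear orders. *)
definition social_choice_function ::
    "nat \<Rightarrow> 'a set \<Rightarrow> ((nat \<Rightarrow> 'a rel) \<Rightarrow> 'a set \<Rightarrow> 'a) \<Rightarrow> bool" where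
  "social_choice_function n X F \<longleftrightarrow> (\<forall>\<pi>\<in>profiles n X. choice_function X (F \<pi>))"

definition individual_choices :: "nat \<Rightarrow> (nat \<Rightarrow> 'a rel) \<Rightarrow> 'a set \<Rightarrow> (nat \<Rightarrow> 'a)" where
  "individual_choices n \<pi> S = (\<lambda>i\<in>{1..n}. rational_choice (\<pi> i) S)"

(* f is the function F_S : S^n \<rightarrow> S of condition (IRA). *)
definition local_rule ::
    "nat \<Rightarrow> 'a set \<Rightarrow> ((nat \<Rightarrow> 'a rel) \<Rightarrow> 'a set \<Rightarrow> 'a) \<Rightarrow> 'a set \<Rightarrow> ((nat \<Rightarrow> 'a) \<Rightarrow> 'a) \<Rightarrow> bool" where
  "local_rule n X F S f \<longleftrightarrow>
     f \<in> (\<Pi>\<^sub>E i\<in>{1..n}. S) \<rightarrow> S \<and>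
     (\<forall>\<pi>\<in>profiles n X. F \<pi> S = f (individual_choices n \<pi> S))"

(* Condition (IRA) *)
definition independent_of_rejected_alternatives ::
    "nat \<Rightarrow> 'a set \<Rightarrow> ((nat \<Rightarrow> 'a rel) \<Rightarrow> 'a set \<Rightarrow> 'a) \<Rightarrow> bool" where
  "independent_of_rejected_alternatives n X F \<longleftrightarrow>
     (\<forall>S\<in>nonempty_subsets X. \<exists>f. local_rule n X F S f)"

(* Condition (P) *)
definition pareto ::
    "nat \<Rightarrow> 'a set \<Rightarrow> ((nat \<Rightarrow> 'a rel) \<Rightarrow> 'a set \<Rightarrow> 'a) \<Rightarrow> bool" where
  "pareto n X F \<longleftrightarrow>
     (\<forall>\<pi>\<in>profiles n X. \<forall>S\<in>nonempty_subsets X.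
        F \<pi> S \<in> (\<lambda>i. rational_choice (\<pi> i) S) ` {1..n})"

definition transport_order :: "('a \<Rightarrow> 'a) \<Rightarrow> 'a rel \<Rightarrow> 'a rel" where
  "transport_order \<sigma> \<pi> = map_prod \<sigma> \<sigma> ` \<pi>"

(* Condition (N1') *)
definition neutral ::
    "nat \<Rightarrow> 'a set \<Rightarrow> ((nat \<Rightarrow> 'a rel) \<Rightarrow> 'a set \<Rightarrow> 'a) \<Rightarrow> bool" where
  "neutral n X F \<longleftrightarrow>
     (\<forall>\<sigma>. \<sigma> permutes X \<longrightarrow>
       (\<forall>\<pi>\<in>profiles n X. \<forall>S\<in>nonempty_subsets X.
          F (\<lambda>i\<in>{1..n}. transport_order \<sigma> (\<pi> i)) (\<sigma> ` S) = \<sigma> (F \<pi> S)))"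

(* Condition (A2'); the carrier of sym_group n is the set of permutations of {1..n}. *)
definition weakly_anonymous ::
    "nat \<Rightarrow> 'a set \<Rightarrow> ((nat \<Rightarrow> 'a rel) \<Rightarrow> 'a set \<Rightarrow> 'a) \<Rightarrow> bool" where
  "weakly_anonymous n X F \<longleftrightarrow>
     (\<exists>G. subgroup G (sym_group n) \<and>
          (\<forall>i\<in>{1..n}. \<forall>j\<in>{1..n}. \<exists>\<tau>\<in>G. \<tau> i = j) \<and>
          (\<forall>\<tau>\<in>G. \<forall>\<pi>\<in>profiles n X. \<forall>S\<in>nonempty_subsets X.
             F (\<lambda>i. \<pi> (\<tau> i)) S = F \<pi> S))"

(* Condition (M'). Every tuple in S^n is a tuple of individual choices, so under (IRA) the
   function F_S exists and is unique on S^n; hence quantifying over all f is harmless. *)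
definition monotone_choice ::
    "nat \<Rightarrow> 'a set \<Rightarrow> ((nat \<Rightarrow> 'a rel) \<Rightarrow> 'a set \<Rightarrow> 'a) \<Rightarrow> bool" where
  "monotone_choice n X F \<longleftrightarrow>
     (\<forall>S\<in>nonempty_subsets X. \<forall>f. local_rule n X F S f \<longrightarrow>
       (\<forall>x\<in>(\<Pi>\<^sub>E i\<in>{1..n}. S). \<forall>s\<in>S. \<forall>i\<in>{1..n}.
          f x = s \<and> x i \<noteq> s \<longrightarrow> f (x(i := s)) = s))"

end

(*
  For nu we perturb the uniform distribution on orders so that, for every S at once, c_pi(S)
  takes the value c0(S) with probability 1/|S| + (|S|-1) eps and every other element of S with the
  same probability 1/|S| - eps. The equality of the other probabilities matters: moving along
  the segment from the uniform distribution to this one only transfers mass from other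
  alternatives to s = c0(S), so by (M') the probability of F_S = s increases, from 1/|S| (by (N1')).
  If it stayed below some bound smaller than 1, then by the mean value theorem and a Russo formula
  the total influence would be at most 1/eps at some intermediate distribution, and by (A2') each
  individual influence at most 1/(eps n). This contradicts the inequality of Falik and
  Samorodnitsky, obtained by applying a logarithmic Sobolev inequality to the martingale
  differences of the indicator function of F_S = s.
*)
theory Submission
  imports Defs
begin

text \<open>(IRA) turns the choice from S into a function of n independent choices from S, so only
  the law of a single choice from S matters and the sets can be handled one at a time, joined by a
  union bound. The obstacle is to prescribe these laws for all S with one \<nu>. It is overcome by
  signed weights on orders that move mass between two alternatives of a single S and change the
  choice law of no other set; corrections for different sets can then simply be added to the uniform
  weights. Their size is bounded in terms of m alone, so \<epsilon> is independent of c0 and \<nu>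
  is independent of \<delta>.

  The contradiction is logarithmic. Martingale differences of L1 norm at most 1/(\<epsilon> n) have
  total entropy at least of order V ln n, where V is the variance, whereas the Sobolev side is at
  most a constant times the total influence, hence bounded in n. V stays away from 0 while the
  probability lies between 1/m and \<delta>. All atoms on the segment are at least 1/(2m), so a
  crude Sobolev constant depending on the smallest atom is good enough.\<close>

section \<open>Logarithmic Sobolev inequality on finite product spaces\<close>

text \<open>Tuples are total functions on the naturals, so that updating a coordinate never leaves
  the domain and averages over different coordinates compose freely. The weights may have any sign:
  besides probabilities they will also be derivatives of probabilities.\<close>

definition avg :: "'b set \<Rightarrow> ('b \<Rightarrow> real) \<Rightarrow> nat \<Rightarrow> ((nat \<Rightarrow> 'b) \<Rightarrow> real) \<Rightarrow> (nat \<Rightarrow> 'b) \<Rightarrow> real" where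
  "avg S w j g x = (\<Sum>y\<in>S. w y * g (x(j := y)))"

text \<open>The result is still a function of the tuple: for probability weights it is the
  conditional expectation that integrates out coordinates 1 to k and keeps the others. Coordinate 0
  is never averaged, in accordance with individuals numbered from 1.\<close>

primrec expn :: "'b set \<Rightarrow> ('b \<Rightarrow> real) \<Rightarrow> nat \<Rightarrow> ((nat \<Rightarrow> 'b) \<Rightarrow> real) \<Rightarrow> (nat \<Rightarrow> 'b) \<Rightarrow> real" where
  "expn S w 0 g = g"
| "expn S w (Suc k) g = avg S w (Suc k) (expn S w k g)"

lemma avg_add: "avg S w j (\<lambda>x. g x + h x) x = avg S w j g x + avg S w j h x"
  by (simp add: avg_def algebra_simps sum.distrib)

lemma avg_cmult: "avg S w j (\<lambda>x. c * g x) x = c * avg S w j g x"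
  by (simp add: avg_def sum_distrib_left algebra_simps)

lemma avg_diff: "avg S w j (\<lambda>x. g x - h x) x = avg S w j g x - avg S w j h x"
  by (simp add: avg_def algebra_simps sum_subtractf)

lemma avg_commute: "i \<noteq> j \<Longrightarrow> avg S w i (avg S v j g) = avg S v j (avg S w i g)"
  unfolding avg_def sum_distrib_left
  by (rule ext, subst sum.swap) (auto intro!: sum.cong simp: fun_upd_twist mult.left_commute)

lemma expn_add: "expn S w k (\<lambda>x. g x + h x) x = expn S w k g x + expn S w k h x"
proof (induction k arbitrary: x)
  case (Suc k)
  then have "expn S w k (\<lambda>x. g x + h x) = (\<lambda>x. expn S w k g x + expn S w k h x)" by blast
  then show ?case by (simp add: avg_add)
qed simp

lemma expn_cmult: "expn S w k (\<lambda>x. c * g x) x = c * expn S w k g x"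
proof (induction k arbitrary: x)
  case (Suc k)
  then have "expn S w k (\<lambda>x. c * g x) = (\<lambda>x. c * expn S w k g x)" by blast
  then show ?case by (simp add: avg_cmult)
qed simp

lemma expn_diff: "expn S w k (\<lambda>x. g x - h x) x = expn S w k g x - expn S w k h x"
  using expn_add[of S w k g "\<lambda>x. (-1) * h x" x] expn_cmult[of S w k "-1" h x] by simp

text \<open>The weights \<open>v\<close> and \<open>w\<close> may differ, hence the restriction to a
  coordinate beyond those already averaged.\<close>

lemma avg_expn_commute: "j > k \<Longrightarrow> avg S v j (expn S w k g) = expn S w k (avg S v j g)"
  by (induction k) (simp_all add: avg_commute[of j])

section \<open>Conditional expectations of a finite product distribution\<close>

locale finite_distribution =
  fixes S :: "'b set" and w :: "'b \<Rightarrow> real"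
  assumes finite_S: "finite S"
    and w_nonneg: "y \<in> S \<Longrightarrow> 0 \<le> w y"
    and w_sum: "sum w S = 1"
begin

abbreviation "A \<equiv> avg S w"
abbreviation "E \<equiv> expn S w"

definition indep :: "nat \<Rightarrow> ((nat \<Rightarrow> 'b) \<Rightarrow> real) \<Rightarrow> bool" where
  "indep j g \<longleftrightarrow> (\<forall>x y. g (x(j := y)) = g x)"

lemma indep_avg: "indep j (avg S v j g)"
  by (simp add: indep_def avg_def)

lemma avg_indep_mult: "indep j h \<Longrightarrow> A j (\<lambda>x. h x * g x) x = h x * A j g x"
  by (simp add: indep_def avg_def sum_distrib_left algebra_simps)

lemma avg_indep: "indep j h \<Longrightarrow> A j h = h"
  by (rule ext) (simp add: indep_def avg_def w_sum flip: sum_distrib_right)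

lemma avg_mono: "(\<And>x. g x \<le> h x) \<Longrightarrow> A j g x \<le> A j h x"
  by (auto simp: avg_def intro!: sum_mono mult_left_mono w_nonneg)

lemma avg_const: "A j (\<lambda>x. c) = (\<lambda>x. c)"
  by (rule avg_indep) (simp add: indep_def)

lemma expn_const: "E k (\<lambda>x. c) = (\<lambda>x. c)"
  by (induction k) (simp_all add: avg_const)

lemma expn_mono: "(\<And>x. g x \<le> h x) \<Longrightarrow> E k g x \<le> E k h x"
  by (induction k arbitrary: x) (simp_all add: avg_mono)

lemma expn_nonneg: "(\<And>x. 0 \<le> g x) \<Longrightarrow> 0 \<le> E k g x"
  using expn_mono[of "\<lambda>x. 0" g k x] by (simp add: expn_const)

lemma expn_sum: "E k (\<lambda>x. \<Sum>i\<in>I. g i x) x = (\<Sum>i\<in>I. E k (g i) x)"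
  by (induction I rule: infinite_finite_induct) (simp_all add: expn_const expn_add)

lemma expn_abs: "\<bar>E k g x\<bar> \<le> E k (\<lambda>x. \<bar>g x\<bar>) x"
proof -
  have "E k g x \<le> E k (\<lambda>x. \<bar>g x\<bar>) x" by (rule expn_mono) simp
  moreover have "- E k g x \<le> E k (\<lambda>x. \<bar>g x\<bar>) x"
    using expn_mono[of "\<lambda>x. (-1) * g x" "\<lambda>x. \<bar>g x\<bar>" k x] expn_cmult[of S w k "-1" g x] by simp
  ultimately show ?thesis by linarith
qed

lemma avg_expn: "A j (E k g) = E k (A j g)"
proof (induction k)
  case (Suc k)
  show ?case
  proof (cases "j = Suc k")
    case True
    then show ?thesis using Suc by simp
  next
    case False
    then show ?thesis using Suc by (simp add: avg_commute[of j])
  qed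
qed simp

lemma avg_expn_absorb: "j \<in> {1..k} \<Longrightarrow> A j (E k g) = E k g"
proof (induction k)
  case (Suc k)
  show ?case
  proof (cases "j = Suc k")
    case True
    then show ?thesis by (simp add: avg_indep indep_avg)
  next
    case False
    with Suc have "A j (E k g) = E k g" by simp
    then show ?thesis using False by (simp add: avg_commute[of j])
  qed
qed simp

lemma expn_avg_absorb: "j \<in> {1..k} \<Longrightarrow> E k (A j g) = E k g"
  using avg_expn avg_expn_absorb by metis

lemma indep_expn: "indep j g \<Longrightarrow> indep j (E k g)"
  using avg_indep avg_expn indep_avg by metis

lemma indep_expn_absorb: "j \<in> {1..k} \<Longrightarrow> indep j (E k g)"
  using avg_expn_absorb indep_avg by metis

lemma expn_expn: "k \<le> n \<Longrightarrow> E n (E k g) = E n g"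
  by (induction k) (simp_all add: expn_avg_absorb)

lemma expn_indep: "(\<And>j. j \<in> {1..n} \<Longrightarrow> indep j g) \<Longrightarrow> E n g = g"
  by (induction n) (simp_all add: avg_indep)

text \<open>The mean of (s g - t h)^2 is a nonnegative quadratic form in s and t. Taking s = c and t
  = b gives c (a c - b^2) \<ge> 0; for c = 0 the form is affine in t, which forces b = 0.\<close>

lemma expn_Cauchy_Schwarz:
  "(E k (\<lambda>x. g x * h x) x)\<^sup>2 \<le> E k (\<lambda>x. (g x)\<^sup>2) x * E k (\<lambda>x. (h x)\<^sup>2) x"
proof -
  define a where "a = E k (\<lambda>x. (g x)\<^sup>2) x"
  define b where "b = E k (\<lambda>x. g x * h x) x"
  define c where "c = E k (\<lambda>x. (h x)\<^sup>2) x"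
  have quad: "0 \<le> s\<^sup>2 * a - 2 * s * t * b + t\<^sup>2 * c" for s t
  proof -
    have "0 \<le> E k (\<lambda>x. (s * g x - t * h x)\<^sup>2) x" by (rule expn_nonneg) simp
    also have "(\<lambda>x. (s * g x - t * h x)\<^sup>2) =
        (\<lambda>x. s\<^sup>2 * (g x)\<^sup>2 + (- 2 * s * t) * (g x * h x) + t\<^sup>2 * (h x)\<^sup>2)"
      by (auto simp: power2_eq_square algebra_simps)
    also have "E k \<dots> x = s\<^sup>2 * a - 2 * s * t * b + t\<^sup>2 * c"
      unfolding expn_add expn_cmult a_def b_def c_def by simp
    finally show ?thesis .
  qed
  have c0: "0 \<le> c" unfolding c_def by (rule expn_nonneg) simp
  show ?thesis unfolding a_def[symmetric] b_def[symmetric] c_def[symmetric]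
  proof (cases "c = 0")
    case True
    have "b = 0"
    proof (rule ccontr)
      assume "b \<noteq> 0"
      then show False using quad[of 1 "(a + 1) / (2 * b)"] True by (simp add: field_simps)
    qed
    with True show "b\<^sup>2 \<le> a * c" by simp
  next
    case False
    have "0 \<le> c * (a * c - b\<^sup>2)"
      using quad[of c b] by (simp add: power2_eq_square algebra_simps)
    with False c0 have "0 \<le> a * c - b\<^sup>2" by (simp add: zero_le_mult_iff)
    then show "b\<^sup>2 \<le> a * c" by simp
  qed
qed

end

lemma power2_sum_le: "(a + b)\<^sup>2 \<le> 2 * a\<^sup>2 + 2 * b\<^sup>2" for a b :: real
  using sum_squares_bound[of a b] by (simp add: power2_sum)

text \<open>A lower bound on the atoms bounds every value of a nonnegative function on S by its mean
  divided by \<alpha>. This is the origin of the factor 1/\<alpha> in the logarithmic Sobolev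
  inequality.\<close>

locale positive_distribution = finite_distribution +
  fixes \<alpha> :: real
  assumes alpha_pos: "0 < \<alpha>" and alpha_le: "y \<in> S \<Longrightarrow> \<alpha> \<le> w y"
begin

lemma S_nonempty: "S \<noteq> {}"
  using w_sum by auto

lemma alpha_le_1: "\<alpha> \<le> 1"
proof -
  obtain y where y: "y \<in> S" using S_nonempty by blast
  have "\<alpha> \<le> w y" using alpha_le y .
  also have "\<dots> \<le> sum w S" using y finite_S by (intro member_le_sum) (auto intro: w_nonneg)
  finally show ?thesis by (simp add: w_sum)
qed

text \<open>Since ln t \<le> t - 1, the entropy of q in one coordinate is at most its variance
  divided by its mean H. The variance is at most the second moment about any constant; for c, the
  partial mean of (A j g)^2, which is free of coordinate j, the difference q - c is the mean of (g -
  a)(g + a), and Cauchy-Schwarz splits off the desired (g - a)^2. The other factor is at most 4 H /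
  \<alpha>, so H cancels.\<close>

lemma entropy_step:
  defines "h \<equiv> \<lambda>g k x. E k (\<lambda>x. (g x)\<^sup>2) x"
  shows "A j (\<lambda>x. h g k x * ln (h g k x)) x - A j (h g k) x * ln (A j (h g k) x)
     \<le> 4 / \<alpha> * E k (A j (\<lambda>x. (g x - A j g x)\<^sup>2)) x"
proof -
  define H where "H = A j (h g k) x"
  define a where "a = A j g"
  define c where "c = h a k x"
  define q where "q y = h g k (x(j := y))" for y
  define D where "D = A j (E k (\<lambda>x. (g x - a x)\<^sup>2)) x"
  have D: "D = E k (A j (\<lambda>x. (g x - A j g x)\<^sup>2)) x" by (simp add: D_def a_def avg_expn)
  have q0: "0 \<le> q y" for y unfolding q_def h_def by (rule expn_nonneg) simp
  have H_sum: "H = (\<Sum>y\<in>S. w y * q y)" by (simp add: H_def avg_def q_def)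
  have H0: "0 \<le> H" unfolding H_sum by (intro sum_nonneg mult_nonneg_nonneg w_nonneg q0)
  have D0: "0 \<le> D" unfolding D by (rule expn_nonneg) (auto simp: avg_def intro!: sum_nonneg mult_nonneg_nonneg w_nonneg)
  have lhs: "A j (\<lambda>x. h g k x * ln (h g k x)) x = (\<Sum>y\<in>S. w y * (q y * ln (q y)))"
    by (simp add: avg_def q_def)
  have q_le: "\<alpha> * q y \<le> H" if y: "y \<in> S" for y
  proof -
    have "\<alpha> * q y \<le> w y * q y" using alpha_le[OF y] q0 by (rule mult_right_mono)
    also have "\<dots> \<le> H" unfolding H_sum using y finite_S
      by (intro member_le_sum[of y S "\<lambda>y. w y * q y"]) (auto intro!: mult_nonneg_nonneg w_nonneg q0)
    finally show ?thesis .
  qed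
  have "(\<Sum>y\<in>S. w y * (q y * ln (q y))) - H * ln H \<le> 4 / \<alpha> * D"
  proof (cases "H = 0")
    case True
    have "q y = 0" if "y \<in> S" for y
    proof -
      have "\<alpha> * q y \<le> 0" using q_le[OF that] True by simp
      then show ?thesis using q0[of y] alpha_pos by (simp add: mult_le_0_iff)
    qed
    then have "(\<Sum>y\<in>S. w y * (q y * ln (q y))) = 0" by (intro sum.neutral) auto
    with True D0 alpha_pos show ?thesis by simp
  next
    case False
    with H0 have Hp: "0 < H" by simp
    have ac: "h a k (x(j := y)) = c" for y
    proof -
      have "indep j (\<lambda>x. (a x)\<^sup>2)" using indep_avg[of j w g] by (simp add: a_def indep_def)
      then show ?thesis using indep_expn[of j "\<lambda>x. (a x)\<^sup>2" k] by (simp add: indep_def h_def c_def)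
    qed
    \<comment> \<open>Jensen's inequality in coordinate j; it yields c \<le> H.\<close>
    have "(a z)\<^sup>2 \<le> A j (\<lambda>x. (g x)\<^sup>2) z" for z
    proof -
      have "0 \<le> A j (\<lambda>x. (g x - a x)\<^sup>2) z"
        by (auto simp: avg_def intro!: sum_nonneg mult_nonneg_nonneg w_nonneg)
      also have "(\<lambda>x. (g x - a x)\<^sup>2) = (\<lambda>x. ((g x)\<^sup>2 - 2 * (a x * g x)) + a x * a x)"
        by (auto simp: power2_eq_square algebra_simps)
      also have "A j \<dots> z = A j (\<lambda>x. (g x)\<^sup>2) z - 2 * (a z * a z) + a z * a z"
        unfolding avg_add avg_diff avg_cmult
        by (simp add: a_def avg_indep_mult indep_avg avg_indep)
      finally show ?thesis by (simp add: power2_eq_square)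
    qed
    then have "c \<le> E k (A j (\<lambda>x. (g x)\<^sup>2)) x" unfolding c_def h_def by (rule expn_mono)
    then have cH: "c \<le> H" unfolding H_def h_def avg_expn[symmetric] by (simp add: eta_contract_eq)
    have qc: "(q y - c)\<^sup>2 \<le> 4 * H / \<alpha> * E k (\<lambda>x. (g x - a x)\<^sup>2) (x(j := y))" if y: "y \<in> S" for y
    proof -
      define z where "z = x(j := y)"
      have "q y - c = E k (\<lambda>x. (g x - a x) * (g x + a x)) z"
        unfolding ac[of y, symmetric] q_def h_def z_def expn_diff[symmetric]
        by (simp add: power2_eq_square algebra_simps)
      then have "(q y - c)\<^sup>2 \<le> E k (\<lambda>x. (g x - a x)\<^sup>2) z * E k (\<lambda>x. (g x + a x)\<^sup>2) z"
        by (simp add: expn_Cauchy_Schwarz)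
      moreover have "E k (\<lambda>x. (g x + a x)\<^sup>2) z \<le> 4 * H / \<alpha>"
      proof -
      have "E k (\<lambda>x. (g x + a x)\<^sup>2) z \<le> E k (\<lambda>x. 2 * (g x)\<^sup>2 + 2 * (a x)\<^sup>2) z"
        by (rule expn_mono, rule power2_sum_le)
      also have "\<dots> = 2 * q y + 2 * c"
        unfolding expn_add expn_cmult ac[of y, symmetric] by (simp add: q_def h_def z_def)
      also have "\<dots> \<le> 4 * H / \<alpha>"
      proof -
        have "\<alpha> * c \<le> \<alpha> * H" using cH alpha_pos by simp
        also have "\<dots> \<le> 1 * H" using alpha_le_1 H0 by (rule mult_right_mono)
        finally have "\<alpha> * c \<le> H" by simp
        then show ?thesis using q_le[OF y] alpha_pos by (simp add: field_simps)
      qed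
      finally show ?thesis .
      qed
      moreover have "0 \<le> E k (\<lambda>x. (g x - a x)\<^sup>2) z" by (rule expn_nonneg) simp
      ultimately have "(q y - c)\<^sup>2 \<le> 4 * H / \<alpha> * E k (\<lambda>x. (g x - a x)\<^sup>2) z"
        using mult_left_mono[of "E k (\<lambda>x. (g x + a x)\<^sup>2) z" "4 * H / \<alpha>" "E k (\<lambda>x. (g x - a x)\<^sup>2) z"]
        unfolding mult.commute[of "4 * H / \<alpha>"] by linarith
      then show ?thesis unfolding z_def .
    qed
    have pt: "q y * ln (q y) \<le> q y * ln H + (q y)\<^sup>2 / H - q y" for y
    proof (cases "q y = 0")
      case False
      with q0[of y] have qp: "0 < q y" by simp
      have "ln (q y) - ln H \<le> q y / H - 1"
        using ln_le_minus_one[of "q y / H"] qp Hp by (simp add: ln_div)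
      then have "q y * (ln (q y) - ln H) \<le> q y * (q y / H - 1)" using qp by simp
      then show ?thesis by (simp add: algebra_simps power2_eq_square)
    qed simp
    have "(\<Sum>y\<in>S. w y * (q y * ln (q y))) \<le> (\<Sum>y\<in>S. w y * (q y * ln H + (q y)\<^sup>2 / H - q y))"
      by (intro sum_mono mult_left_mono pt w_nonneg)
    also have "\<dots> = H * ln H + (\<Sum>y\<in>S. w y * (q y)\<^sup>2) / H - H"
    proof -
      have "(\<Sum>y\<in>S. w y * (q y * ln H + (q y)\<^sup>2 / H - q y)) =
          (\<Sum>y\<in>S. ln H * (w y * q y) + w y * (q y)\<^sup>2 / H - w y * q y)"
        by (intro sum.cong) (auto simp: algebra_simps)
      then show ?thesis
        by (simp add: sum.distrib sum_subtractf H_sum[symmetric] sum_divide_distrib[symmetric]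
            sum_distrib_left[symmetric])
    qed
    finally have "(\<Sum>y\<in>S. w y * (q y * ln (q y))) - H * ln H \<le> (\<Sum>y\<in>S. w y * (q y)\<^sup>2) / H - H"
      by simp
    also have "\<dots> = ((\<Sum>y\<in>S. w y * (q y)\<^sup>2) - H\<^sup>2) / H" using Hp by (simp add: field_simps power2_eq_square)
    also have "(\<Sum>y\<in>S. w y * (q y)\<^sup>2) - H\<^sup>2 \<le> (\<Sum>y\<in>S. w y * (q y - c)\<^sup>2)"
    proof -
      have "(\<Sum>y\<in>S. w y * (q y - c)\<^sup>2) = (\<Sum>y\<in>S. w y * (q y)\<^sup>2 - 2 * c * (w y * q y) + c\<^sup>2 * w y)"
        by (intro sum.cong) (auto simp: power2_eq_square algebra_simps)
      also have "\<dots> = (\<Sum>y\<in>S. w y * (q y)\<^sup>2) - 2 * c * H + c\<^sup>2"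
        by (simp add: H_sum sum.distrib sum_subtractf w_sum flip: sum_distrib_left)
      finally show ?thesis using sum_squares_bound[of c H] by (simp add: power2_eq_square)
    qed
    also have "(\<Sum>y\<in>S. w y * (q y - c)\<^sup>2) \<le>
        (\<Sum>y\<in>S. w y * (4 * H / \<alpha> * E k (\<lambda>x. (g x - a x)\<^sup>2) (x(j := y))))"
      by (intro sum_mono mult_left_mono qc w_nonneg)
    also have "\<dots> = 4 * H / \<alpha> * D"
      by (simp add: D_def avg_def sum_distrib_left algebra_simps)
    finally show ?thesis using Hp by (simp add: divide_right_mono)
  qed
  then show ?thesis unfolding lhs H_def[symmetric] D[symmetric] .
qed

text \<open>Entropy tensorizes: over n + 1 coordinates it is the mean of the entropy over the first
  n, bounded by induction, plus the entropy of the partial mean \<open>h\<close> in the last one,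
  bounded by \<open>entropy_step\<close>. The value of ln at 0 is harmless because the logarithm is
  always multiplied by its argument.\<close>

lemma log_Sobolev:
  "E n (\<lambda>x. (g x)\<^sup>2 * ln ((g x)\<^sup>2)) x - E n (\<lambda>x. (g x)\<^sup>2) x * ln (E n (\<lambda>x. (g x)\<^sup>2) x)
    \<le> 4 / \<alpha> * (\<Sum>k=1..n. E n (\<lambda>x. (g x - A k g x)\<^sup>2) x)"
proof (induction n arbitrary: x)
  case (Suc n)
  define h where "h = E n (\<lambda>x. (g x)\<^sup>2)"
  define d where "d k = (\<lambda>x. (g x - A k g x)\<^sup>2)" for k
  have "A (Suc n) (E n (\<lambda>x. (g x)\<^sup>2 * ln ((g x)\<^sup>2))) x
     \<le> A (Suc n) (\<lambda>x. h x * ln (h x) + 4 / \<alpha> * (\<Sum>k=1..n. E n (d k) x)) x"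
    by (rule avg_mono) (use Suc in \<open>simp add: h_def d_def algebra_simps\<close>)
  also have "\<dots> = A (Suc n) (\<lambda>x. h x * ln (h x)) x + 4 / \<alpha> * (\<Sum>k=1..n. A (Suc n) (E n (d k)) x)"
  proof -
    have "A (Suc n) (\<lambda>x. \<Sum>k=1..n. E n (d k) x) x = (\<Sum>k=1..n. A (Suc n) (E n (d k)) x)"
      unfolding avg_def sum_distrib_left by (rule sum.swap)
    then show ?thesis by (simp only: avg_add avg_cmult)
  qed
  also have "A (Suc n) (\<lambda>x. h x * ln (h x)) x
      \<le> A (Suc n) h x * ln (A (Suc n) h x) + 4 / \<alpha> * A (Suc n) (E n (d (Suc n))) x"
    using entropy_step[of "Suc n" n g x] unfolding d_def avg_expn h_def by (simp add: eta_contract_eq)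
  finally show ?case by (simp add: h_def d_def algebra_simps)
qed simp

text \<open>An L1 norm that is small compared with the L2 norm forces the entropy to be at least V
  ln (V / b^2). The left side is the tangent line of this convex function of V at V = b^2 \<theta>;
  being affine in V, it can be summed over several functions without knowing how the total of their
  V is distributed among them.\<close>

lemma entropy_lower_bound:
  assumes b: "0 < b" "E n (\<lambda>x. \<bar>g x\<bar>) x \<le> b" and \<theta>: "0 < \<theta>"
  defines "V \<equiv> E n (\<lambda>x. (g x)\<^sup>2) x"
  shows "V * ln \<theta> + V - b\<^sup>2 * \<theta> \<le> E n (\<lambda>x. (g x)\<^sup>2 * ln ((g x)\<^sup>2)) x - V * ln V"
proof -
  have low: "2 * V * (ln c + 1) - 2 * c * b \<le> E n (\<lambda>x. (g x)\<^sup>2 * ln ((g x)\<^sup>2)) x" if c: "0 < c" for c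
  proof -
    \<comment> \<open>This is ln (c / |g|) \<le> c / |g| - 1, multiplied by 2 g^2. Below, c is V /
      b, or b \<theta> / 2 when V = 0, which then reproduces the term b^2 \<theta>.\<close>
    have pt: "(2 * (ln c + 1)) * (g y)\<^sup>2 - (2 * c) * \<bar>g y\<bar> \<le> (g y)\<^sup>2 * ln ((g y)\<^sup>2)" for y
    proof (cases "g y = 0")
      case False
      then have gp: "0 < \<bar>g y\<bar>" by simp
      have "ln c - ln \<bar>g y\<bar> \<le> c / \<bar>g y\<bar> - 1"
        using ln_le_minus_one[of "c / \<bar>g y\<bar>"] gp c by (simp add: ln_div)
      then have "\<bar>g y\<bar> * \<bar>g y\<bar> * (ln c - ln \<bar>g y\<bar>) \<le> \<bar>g y\<bar> * \<bar>g y\<bar> * (c / \<bar>g y\<bar> - 1)"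
        by (intro mult_left_mono) simp_all
      also have "\<dots> = c * \<bar>g y\<bar> - \<bar>g y\<bar> * \<bar>g y\<bar>" using gp by (simp add: field_simps)
      finally have "(g y)\<^sup>2 * (ln c - ln \<bar>g y\<bar>) \<le> c * \<bar>g y\<bar> - (g y)\<^sup>2"
        by (simp add: power2_eq_square flip: abs_mult)
      moreover have "ln ((g y)\<^sup>2) = 2 * ln \<bar>g y\<bar>"
        using ln_realpow[of "\<bar>g y\<bar>" 2] gp by simp
      ultimately show ?thesis by (simp add: algebra_simps)
    qed simp
    have "2 * V * (ln c + 1) - 2 * c * b \<le> 2 * (ln c + 1) * V - 2 * c * E n (\<lambda>x. \<bar>g x\<bar>) x"
      using b(2) c by (simp add: algebra_simps)
    also have "\<dots> = E n (\<lambda>y. (2 * (ln c + 1)) * (g y)\<^sup>2 - (2 * c) * \<bar>g y\<bar>) x"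
      unfolding expn_diff expn_cmult V_def ..
    also have "\<dots> \<le> E n (\<lambda>x. (g x)\<^sup>2 * ln ((g x)\<^sup>2)) x" by (rule expn_mono) (rule pt)
    finally show ?thesis .
  qed
  have V0: "0 \<le> V" unfolding V_def by (rule expn_nonneg) simp
  show ?thesis
  proof (cases "V = 0")
    case True
    then show ?thesis using low[of "b * \<theta> / 2"] b \<theta> by (simp add: power2_eq_square algebra_simps)
  next
    case False
    with V0 have Vp: "0 < V" by simp
    have "ln (b\<^sup>2 * \<theta> / V) \<le> b\<^sup>2 * \<theta> / V - 1"
      using b \<theta> Vp by (intro ln_le_minus_one) simp
    then have "V * ln (b\<^sup>2 * \<theta> / V) \<le> V * (b\<^sup>2 * \<theta> / V - 1)"
      using Vp by (intro mult_left_mono) auto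
    also have "\<dots> = b\<^sup>2 * \<theta> - V" using Vp by (simp add: field_simps)
    finally have "V * (2 * ln b + ln \<theta> - ln V) \<le> b\<^sup>2 * \<theta> - V"
      using b \<theta> Vp by (simp add: ln_div ln_mult ln_realpow)
    moreover have "2 * V * (ln V - ln b) \<le> E n (\<lambda>x. (g x)\<^sup>2 * ln ((g x)\<^sup>2)) x"
      using low[of "V / b"] b Vp by (simp add: ln_div algebra_simps)
    ultimately show ?thesis by (simp add: algebra_simps)
  qed
qed

end

section \<open>Martingale decomposition of the variance\<close>

context finite_distribution
begin

(* The Doob martingale E i f, averaged over the first i coordinates, has orthogonal increments. *)
lemma expn_power2_increment:
  assumes "i < n"
  shows "E n (\<lambda>x. (E i f x - E (Suc i) f x)\<^sup>2) x =
    E n (\<lambda>x. (E i f x)\<^sup>2) x - E n (\<lambda>x. (E (Suc i) f x)\<^sup>2) x"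
proof -
  have step: "A (Suc i) (\<lambda>x. (E i f x - E (Suc i) f x)\<^sup>2) =
      (\<lambda>x. A (Suc i) (\<lambda>x. (E i f x)\<^sup>2) x - (E (Suc i) f x)\<^sup>2)"
  proof
    fix z
    have eq: "(\<lambda>x. (E i f x - E (Suc i) f x)\<^sup>2) =
        (\<lambda>x. (E i f x)\<^sup>2 - 2 * (E (Suc i) f x * E i f x) + E (Suc i) f x * E (Suc i) f x)"
      by (auto simp: power2_eq_square algebra_simps)
    have ind: "indep (Suc i) (E (Suc i) f)" by (rule indep_expn_absorb) simp
    show "A (Suc i) (\<lambda>x. (E i f x - E (Suc i) f x)\<^sup>2) z =
        A (Suc i) (\<lambda>x. (E i f x)\<^sup>2) z - (E (Suc i) f z)\<^sup>2"
      unfolding eq avg_add avg_diff avg_cmult avg_indep_mult[OF ind] avg_indep[OF ind]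
      by (simp add: power2_eq_square)
  qed
  have absorb: "E n (A (Suc i) g) = E n g" for g using assms by (intro expn_avg_absorb) simp
  have "E n (\<lambda>x. (E i f x - E (Suc i) f x)\<^sup>2) x =
      E n (\<lambda>x. A (Suc i) (\<lambda>x. (E i f x)\<^sup>2) x - (E (Suc i) f x)\<^sup>2) x"
    unfolding step[symmetric] absorb ..
  also have "\<dots> = E n (\<lambda>x. (E i f x)\<^sup>2) x - E n (\<lambda>x. (E (Suc i) f x)\<^sup>2) x"
    unfolding expn_diff absorb[of "\<lambda>x. (E i f x)\<^sup>2", symmetric] by (simp add: eta_contract_eq)
  finally show ?thesis .
qed

lemma expn_power2_increments:
  "(\<Sum>i<n. E n (\<lambda>x. (E i f x - E (Suc i) f x)\<^sup>2) x) = E n (\<lambda>x. (f x)\<^sup>2) x - (E n f x)\<^sup>2"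
proof -
  have "(\<Sum>i<n. E n (\<lambda>x. (E i f x - E (Suc i) f x)\<^sup>2) x) =
      (\<Sum>i<n. E n (\<lambda>x. (E i f x)\<^sup>2) x - E n (\<lambda>x. (E (Suc i) f x)\<^sup>2) x)"
    by (intro sum.cong expn_power2_increment) auto
  also have "\<dots> = E n (\<lambda>x. (E 0 f x)\<^sup>2) x - E n (\<lambda>x. (E n f x)\<^sup>2) x" by (rule sum_lessThan_telescope')
  also have "E n (\<lambda>x. (E n f x)\<^sup>2) = (\<lambda>x. (E n f x)\<^sup>2)"
    using indep_expn_absorb[of _ n f] by (intro expn_indep) (simp add: indep_def)
  finally show ?thesis by simp
qed

end

text \<open>The differences \<open>d i f\<close> average f - A (i + 1) f, so their L1 norms are at
  most b, while their second moments add up to V; together their entropies are at least V ln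
  \<theta>. On the Sobolev side, \<open>d i\<close> commutes with f \<mapsto> f - A k f, so for each
  k the terms of all the differences add up to the variance of f - A k f, by the same orthogonality
  applied to that function.\<close>

lemma (in positive_distribution) Falik_Samorodnitsky:
  assumes b: "0 < b" "\<And>i. i \<in> {1..n} \<Longrightarrow> E n (\<lambda>x. \<bar>f x - A i f x\<bar>) x \<le> b"
    and V: "V = E n (\<lambda>x. (f x)\<^sup>2) x - (E n f x)\<^sup>2" "0 < V"
  shows "V * ln (V / (real n * b\<^sup>2)) \<le> 4 / \<alpha> * (\<Sum>k=1..n. E n (\<lambda>x. (f x - A k f x)\<^sup>2) x)"
proof -
  define d where "d i f x = E i f x - E (Suc i) f x" for i f x
  have n: "0 < n" using V by (cases n) auto
  \<comment> \<open>Chosen so that the affine remainder V - n b^2 \<theta> of the summed lower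
    bounds vanishes.\<close>
  define \<theta> where "\<theta> = V / (real n * b\<^sup>2)"
  have \<theta>: "0 < \<theta>" using V b n by (simp add: \<theta>_def)
  define W where "W i = E n (\<lambda>x. (d i f x)\<^sup>2) x" for i
  have sumW: "(\<Sum>i<n. W i) = V" unfolding W_def d_def V by (rule expn_power2_increments)
  have d_alt: "d i f = E i (\<lambda>x. f x - A (Suc i) f x)" for i f
    by (rule ext) (simp add: d_def expn_diff avg_expn)
  have low: "W i * ln \<theta> + W i - b\<^sup>2 * \<theta> \<le> E n (\<lambda>x. (d i f x)\<^sup>2 * ln ((d i f x)\<^sup>2)) x - W i * ln (W i)"
    if i: "i < n" for i
    unfolding W_def
  proof (rule entropy_lower_bound[OF b(1) _ \<theta>])
    have "E n (\<lambda>x. \<bar>d i f x\<bar>) x \<le> E n (E i (\<lambda>x. \<bar>f x - A (Suc i) f x\<bar>)) x"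
      unfolding d_alt by (intro expn_mono expn_abs)
    also have "\<dots> \<le> b" using i b(2)[of "Suc i"] by (simp add: expn_expn)
    finally show "E n (\<lambda>x. \<bar>d i f x\<bar>) x \<le> b" .
  qed
  have comm: "d i f x - A k (d i f) x = d i (\<lambda>x. f x - A k f x) x" for i k x
    unfolding d_def avg_diff expn_diff avg_expn by simp
  have "V * ln \<theta> = V * ln \<theta> + V - real n * (b\<^sup>2 * \<theta>)"
    using n b by (simp add: \<theta>_def)
  also have "\<dots> = (\<Sum>i<n. W i * ln \<theta> + W i - b\<^sup>2 * \<theta>)"
    by (simp add: sum.distrib sum_subtractf sumW flip: sum_distrib_right)
  also have "\<dots> \<le> (\<Sum>i<n. 4 / \<alpha> * (\<Sum>k=1..n. E n (\<lambda>x. (d i f x - A k (d i f) x)\<^sup>2) x))"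
  proof (rule sum_mono)
    fix i assume "i \<in> {..<n}"
    then show "W i * ln \<theta> + W i - b\<^sup>2 * \<theta> \<le> 4 / \<alpha> * (\<Sum>k=1..n. E n (\<lambda>x. (d i f x - A k (d i f) x)\<^sup>2) x)"
      using low[of i] log_Sobolev[of n "d i f" x] unfolding W_def by simp
  qed
  also have "\<dots> = 4 / \<alpha> * (\<Sum>k=1..n. \<Sum>i<n. E n (\<lambda>x. (d i (\<lambda>x. f x - A k f x) x)\<^sup>2) x)"
    unfolding comm by (subst sum.swap) (simp only: sum_distrib_left)
  also have "\<dots> \<le> 4 / \<alpha> * (\<Sum>k=1..n. E n (\<lambda>x. (f x - A k f x)\<^sup>2) x)"
    unfolding d_def expn_power2_increments using alpha_pos by (intro mult_left_mono sum_mono) auto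
  finally show ?thesis by (simp add: \<theta>_def)
qed

section \<open>Sharp thresholds\<close>

context finite_distribution
begin

text \<open>Gives access to the whole product at once: only tuples with entries in S carry weight,
  and all coordinates enter symmetrically, neither of which is visible in the iterated form.\<close>

lemma expn_eq_sum:
  "E n g x = (\<Sum>z\<in>(\<Pi>\<^sub>E i\<in>{1..n}. S). (\<Prod>i\<in>{1..n}. w (z i)) * g (\<lambda>i. if i \<in> {1..n} then z i else x i))"
proof (induction n arbitrary: x)
  case (Suc n)
  let ?P = "\<Pi>\<^sub>E i\<in>{1..n}. S"
  have ins: "{1..Suc n} = insert (Suc n) {1..n}" by auto
  have inj: "inj_on (\<lambda>(y, z). z(Suc n := y)) (S \<times> ?P)"
    by (rule inj_combinator) simp
  have "(\<Sum>z\<in>(\<Pi>\<^sub>E i\<in>{1..Suc n}. S). (\<Prod>i\<in>{1..Suc n}. w (z i)) *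
        g (\<lambda>i. if i \<in> {1..Suc n} then z i else x i)) =
      (\<Sum>(y, z)\<in>S \<times> ?P. (\<Prod>i\<in>{1..Suc n}. w ((z(Suc n := y)) i)) *
        g (\<lambda>i. if i \<in> {1..Suc n} then (z(Suc n := y)) i else x i))"
    unfolding ins PiE_insert_eq by (subst sum.reindex[OF inj]) (simp add: case_prod_unfold)
  also have "\<dots> = (\<Sum>(y, z)\<in>S \<times> ?P. w y * ((\<Prod>i\<in>{1..n}. w (z i)) *
        g (\<lambda>i. if i \<in> {1..n} then z i else (x(Suc n := y)) i)))"
  proof (intro sum.cong refl, clarify)
    fix y z
    have "(\<lambda>i. if i \<in> {1..Suc n} then (z(Suc n := y)) i else x i) =
        (\<lambda>i. if i \<in> {1..n} then z i else (x(Suc n := y)) i)" by (auto simp: fun_eq_iff)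
    moreover have "(\<Prod>i\<in>{1..Suc n}. w ((z(Suc n := y)) i)) = w y * (\<Prod>i\<in>{1..n}. w (z i))"
      unfolding ins by (subst prod.insert) (auto intro!: prod.cong)
    ultimately show "(\<Prod>i\<in>{1..Suc n}. w ((z(Suc n := y)) i)) *
        g (\<lambda>i. if i \<in> {1..Suc n} then (z(Suc n := y)) i else x i) =
        w y * ((\<Prod>i\<in>{1..n}. w (z i)) * g (\<lambda>i. if i \<in> {1..n} then z i else (x(Suc n := y)) i))"
      by (simp only: mult.assoc)
  qed
  also have "\<dots> = E (Suc n) g x"
    by (simp only: expn.simps avg_def Suc.IH sum.cartesian_product[symmetric] sum_distrib_left[symmetric])
  finally show ?case ..
qed simp

lemma expn_mono_on:
  assumes "\<And>x. (\<And>i. i \<in> {1..n} \<Longrightarrow> x i \<in> S) \<Longrightarrow> g x \<le> h x"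
  shows "E n g x \<le> E n h x"
  unfolding expn_eq_sum
  by (intro sum_mono mult_left_mono assms prod_nonneg ballI w_nonneg) auto

lemma expn_cong_on:
  assumes "\<And>x. (\<And>i. i \<in> {1..n} \<Longrightarrow> x i \<in> S) \<Longrightarrow> g x = h x"
  shows "E n g x = E n h x"
  by (intro antisym expn_mono_on) (metis assms order_refl)+

lemma expn_start:
  assumes "\<And>x y. (\<And>i. i \<in> {1..n} \<Longrightarrow> x i = y i) \<Longrightarrow> g x = g y"
  shows "E n g x = E n g y"
  unfolding expn_eq_sum
proof (intro sum.cong refl)
  fix z
  have "g (\<lambda>i. if i \<in> {1..n} then z i else x i) = g (\<lambda>i. if i \<in> {1..n} then z i else y i)"
    by (rule assms) simp
  then show "(\<Prod>i\<in>{1..n}. w (z i)) * g (\<lambda>i. if i \<in> {1..n} then z i else x i) =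
      (\<Prod>i\<in>{1..n}. w (z i)) * g (\<lambda>i. if i \<in> {1..n} then z i else y i)" by simp
qed

lemma expn_permute_coordinates:
  assumes \<tau>: "\<tau> permutes {1..n}"
  shows "E n (\<lambda>x. g (x \<circ> \<tau>)) x = E n g (x \<circ> \<tau>)"
  unfolding expn_eq_sum
proof (rule sum.reindex_bij_witness[of _ "\<lambda>z. z \<circ> inv_into UNIV \<tau>" "\<lambda>z. z \<circ> \<tau>"])
  have \<tau>': "inv_into UNIV \<tau> permutes {1..n}" using \<tau> by (rule permutes_inv)
  have PiE: "z \<circ> p \<in> (\<Pi>\<^sub>E i\<in>{1..n}. S)"
    if "p permutes {1..n}" "z \<in> (\<Pi>\<^sub>E i\<in>{1..n}. S)" for p z
    using that permutes_in_image[OF that(1)] by (auto simp: PiE_def Pi_def extensional_def)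
  fix z assume z: "z \<in> (\<Pi>\<^sub>E i\<in>{1..n}. S)"
  show "z \<circ> \<tau> \<in> (\<Pi>\<^sub>E i\<in>{1..n}. S)" "z \<circ> inv_into UNIV \<tau> \<in> (\<Pi>\<^sub>E i\<in>{1..n}. S)"
    using PiE[OF \<tau> z] PiE[OF \<tau>' z] .
  show "z \<circ> \<tau> \<circ> inv_into UNIV \<tau> = z" "z \<circ> inv_into UNIV \<tau> \<circ> \<tau> = z"
    using permutes_inv_o[OF \<tau>] by (simp_all add: comp_assoc)
  have "(\<Prod>i\<in>{1..n}. w (z i)) = (\<Prod>i\<in>{1..n}. w ((z \<circ> \<tau>) i))"
    using prod.permute[OF \<tau>, of "\<lambda>i. w (z i)"] by (simp add: o_def)
  moreover have "(\<lambda>i. if i \<in> {1..n} then z i else x i) \<circ> \<tau> =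
      (\<lambda>i. if i \<in> {1..n} then (z \<circ> \<tau>) i else (x \<circ> \<tau>) i)"
    using permutes_in_image[OF \<tau>] by (simp only: o_def if_distrib)
  ultimately show "(\<Prod>i\<in>{1..n}. w ((z \<circ> \<tau>) i)) * g (\<lambda>i. if i \<in> {1..n} then (z \<circ> \<tau>) i else (x \<circ> \<tau>) i) =
      (\<Prod>i\<in>{1..n}. w (z i)) * g ((\<lambda>i. if i \<in> {1..n} then z i else x i) \<circ> \<tau>)"
    by simp
qed

lemma expn_permute_values:
  assumes \<sigma>: "\<sigma> permutes S" and w: "\<And>y. y \<in> S \<Longrightarrow> w (\<sigma> y) = w y"
  shows "E k (\<lambda>x. g (\<sigma> \<circ> x)) x = E k g (\<sigma> \<circ> x)"
proof (induction k arbitrary: x)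
  case (Suc k)
  have "(\<Sum>y\<in>S. w y * E k g (\<sigma> \<circ> x(Suc k := y))) = (\<Sum>y\<in>S. w (\<sigma> y) * E k g ((\<sigma> \<circ> x)(Suc k := \<sigma> y)))"
    by (intro sum.cong) (auto simp: w fun_upd_comp)
  also have "\<dots> = (\<Sum>y\<in>S. w y * E k g ((\<sigma> \<circ> x)(Suc k := y)))"
    using sum.permute[OF \<sigma>, of "\<lambda>y. w y * E k g ((\<sigma> \<circ> x)(Suc k := y))"] by (simp add: o_def)
  finally show ?case by (simp only: expn.simps avg_def Suc.IH)
qed simp

text \<open>The mean is multilinear in the weights of the n coordinates, so the product rule
  replaces the weights by their derivative in one coordinate at a time.\<close>

lemma Russo_formula:
  assumes W: "W t = w" "\<And>y. y \<in> S \<Longrightarrow> ((\<lambda>t. W t y) has_real_derivative w' y) (at t)"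
  shows "((\<lambda>t. expn S (W t) n f x) has_real_derivative (\<Sum>i=1..n. E n (avg S w' i f) x)) (at t)"
proof (induction n arbitrary: x)
  case (Suc n)
  have "((\<lambda>t. \<Sum>y\<in>S. W t y * expn S (W t) n f (x(Suc n := y))) has_real_derivative
      (\<Sum>y\<in>S. w' y * E n f (x(Suc n := y)) +
        (\<Sum>i=1..n. E n (avg S w' i f) (x(Suc n := y))) * w y)) (at t)"
    using W(2) Suc.IH by (auto intro!: DERIV_sum DERIV_mult simp: W(1)[symmetric])
  moreover have "(\<Sum>y\<in>S. w' y * E n f (x(Suc n := y)) +
        (\<Sum>i=1..n. E n (avg S w' i f) (x(Suc n := y))) * w y) =
      avg S w' (Suc n) (E n f) x + (\<Sum>i=1..n. E (Suc n) (avg S w' i f) x)"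
  proof -
    have "(\<Sum>y\<in>S. (\<Sum>i=1..n. E n (avg S w' i f) (x(Suc n := y))) * w y) =
        (\<Sum>i=1..n. E (Suc n) (avg S w' i f) x)"
      unfolding sum_distrib_right expn.simps avg_def[of S w "Suc n"]
      by (subst sum.swap) (simp only: mult.commute)
    then show ?thesis by (simp add: sum.distrib avg_def[of S w' "Suc n" "E n f"])
  qed
  \<comment> \<open>After averaging with \<open>w'\<close> the last coordinate no longer occurs, so
    averaging over it again with the probability weights changes nothing.\<close>
  moreover have "avg S w' (Suc n) (E n f) = E (Suc n) (avg S w' (Suc n) f)"
    using avg_indep[OF indep_expn[OF indep_avg[of "Suc n" w' f], of n]] avg_expn_commute[of n "Suc n" S w' w f]
    by simp
  moreover have "(\<lambda>t. expn S (W t) (Suc n) f x) = (\<lambda>t. \<Sum>y\<in>S. W t y * expn S (W t) n f (x(Suc n := y)))"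
    by (simp add: avg_def)
  ultimately show ?case by (simp add: add.commute)
qed simp

end


text \<open>\<open>W\<close> parametrizes the segment from the uniform distribution at t = 0 to the
  biased one at t = \<epsilon>, and \<open>v\<close> bounds the variance from below while the
  probability lies between 1/m and \<delta>. The bound on n says that v ln (v \<epsilon>^2 n)
  exceeds 8 m / \<epsilon>, which is the upper estimate coming from the influences.\<close>

lemma sharp_threshold:
  fixes S :: "'b set" and R :: "(nat \<Rightarrow> 'b) \<Rightarrow> 'b" and n m :: nat and \<epsilon> \<delta> :: real
  assumes S: "finite S" "2 \<le> card S" "card S \<le> m" "s \<in> S"
    and R_in: "\<And>x. x \<in> (\<Pi>\<^sub>E i\<in>{1..n}. S) \<Longrightarrow> R x \<in> S"
    and R_mono: "\<And>x i. x \<in> (\<Pi>\<^sub>E i\<in>{1..n}. S) \<Longrightarrow> i \<in> {1..n} \<Longrightarrow> R x = s \<Longrightarrow> x i \<noteq> s \<Longrightarrow> R (x(i := s)) = s"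
    and R_neutral: "\<And>\<sigma> x. \<sigma> permutes S \<Longrightarrow> x \<in> (\<Pi>\<^sub>E i\<in>{1..n}. S) \<Longrightarrow> R (\<lambda>i\<in>{1..n}. \<sigma> (x i)) = \<sigma> (R x)"
    and R_sym: "\<And>i j. i \<in> {1..n} \<Longrightarrow> j \<in> {1..n} \<Longrightarrow>
      \<exists>\<tau>. \<tau> permutes {1..n} \<and> \<tau> i = j \<and> (\<forall>x\<in>(\<Pi>\<^sub>E i\<in>{1..n}. S). R (x \<circ> \<tau>) = R x)"
    and \<epsilon>: "0 < \<epsilon>" "\<epsilon> \<le> 1 / (2 * real m)"
    and \<delta>: "0 < \<delta>" "\<delta> < 1"
  defines "v \<equiv> (1 - \<delta>) / real m"
  defines "W \<equiv> \<lambda>t y. 1 / real (card S) + t * (real (card S) * of_bool (y = s) - 1)"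
  assumes n: "exp (8 * real m / (\<epsilon> * v)) / (v * \<epsilon>\<^sup>2) < real n"
  shows "\<delta> \<le> expn S (W \<epsilon>) n (\<lambda>x. of_bool (R (restrict x {1..n}) = s)) (\<lambda>_. undefined)"
proof (rule ccontr)
  define r where "r = card S"
  define w' where "w' y = real r * of_bool (y = s) - 1" for y
  \<comment> \<open>The target value u varies because the probability at t = 0 is found by comparing
    all elements of S.\<close>
  define f where "f u x = (of_bool (R (restrict x {1..n}) = u) :: real)" for u x
  define D where "D i = avg S w' i (f s)" for i
  define x0 where "x0 = (\<lambda>_::nat. undefined :: 'b)"
  define G where "G t = expn S (W t) n (f s) x0" for t
  have r2: "2 \<le> r" "r \<le> m" using S by (simp_all add: r_def)
  have W: "W t y = 1 / real r + t * w' y" for t y by (simp add: W_def w'_def r_def)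
  have w'_sum: "sum w' S = 0"
    using S by (simp add: w'_def sum_subtractf r_def flip: sum_distrib_left)
  have v0: "0 < v" using \<delta> r2 by (simp add: v_def)
  have n0: "0 < real n" using n v0 \<epsilon> by (smt (verit) divide_nonneg_nonneg exp_ge_zero mult_nonneg_nonneg zero_le_power2)
  \<comment> \<open>On the segment no atom drops below 1/m - \<epsilon>, which is at least
    1/(2m).\<close>
  have dist: "positive_distribution S (W t) (1 / (2 * real m))" if t: "0 \<le> t" "t \<le> \<epsilon>" for t
  proof -
    have ge: "1 / (2 * real m) \<le> W t y" for y
    proof -
      have "1 / (2 * real m) = 1 / real m - 1 / (2 * real m)" using r2 by (simp add: field_simps)
      also have "\<dots> \<le> 1 / real r - t" using t \<epsilon> r2 by (intro diff_mono) (auto intro!: divide_left_mono)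
      also have "\<dots> \<le> W t y"
        unfolding W w'_def using t r2 by (simp add: algebra_simps)
      finally show ?thesis .
    qed
    show ?thesis
    proof
      show "finite S" by fact
      show "sum (W t) S = 1"
        using r2 w'_sum by (simp add: W sum.distrib r_def flip: sum_distrib_left)
      show "0 < 1 / (2 * real m)" using r2 by simp
      fix y show "1 / (2 * real m) \<le> W t y" by (rule ge)
      then show "0 \<le> W t y" by (rule order_trans[rotated]) simp
    qed
  qed
  have f01: "0 \<le> f u x" "f u x \<le> 1" for u x by (simp_all add: f_def)
  have restr: "restrict x {1..n} \<in> (\<Pi>\<^sub>E i\<in>{1..n}. S)" if "\<And>i. i \<in> {1..n} \<Longrightarrow> x i \<in> S" for x
    using that by auto
  have f_mono: "f s (x(i := y)) \<le> f s (x(i := s))"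
    if x: "\<And>i. i \<in> {1..n} \<Longrightarrow> x i \<in> S" and i: "i \<in> {1..n}" and y: "y \<in> S" for x i y
  proof (cases "y = s \<or> R (restrict (x(i := y)) {1..n}) \<noteq> s")
    case False
    let ?z = "restrict (x(i := y)) {1..n}"
    have "?z(i := s) = restrict (x(i := s)) {1..n}" using i by (auto simp: fun_eq_iff)
    moreover have "R (?z(i := s)) = s"
      using False x y i by (intro R_mono restr) (auto simp: restr)
    ultimately show ?thesis by (simp add: f_def)
  qed (auto simp: f_def)
  \<comment> \<open>As \<open>w'\<close> sums to 0 over S, the derivative in coordinate i is a sum
    of gains from switching i to s, each nonnegative on S-valued tuples by \<open>f_mono\<close>. So
    it dominates every single gain.\<close>
  have D_alt: "D i x = (\<Sum>y\<in>S. f s (x(i := s)) - f s (x(i := y)))" for i x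
  proof -
    have "D i x = real r * (\<Sum>y\<in>S. of_bool (y = s) * f s (x(i := y))) - (\<Sum>y\<in>S. f s (x(i := y)))"
      by (simp add: D_def avg_def w'_def algebra_simps sum_subtractf sum_distrib_left)
    also have "(\<Sum>y\<in>S. of_bool (y = s) * f s (x(i := y))) = f s (x(i := s))"
    proof -
      have "(\<Sum>y\<in>S. of_bool (y = s) * f s (x(i := y))) = (\<Sum>y\<in>S. if y = s then f s (x(i := y)) else 0)"
        by (intro sum.cong) auto
      then show ?thesis using S by simp
    qed
    finally show ?thesis by (simp add: sum_subtractf r_def fun_upd_def)
  qed
  have D_ge: "f s (x(i := s)) - f s (x(i := y)) \<le> D i x"
    if x: "\<And>i. i \<in> {1..n} \<Longrightarrow> x i \<in> S" and i: "i \<in> {1..n}" and y: "y \<in> S" for x i y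
    unfolding D_alt using S f_mono[OF x i] y
    by (intro member_le_sum[of y S "\<lambda>y. f s (x(i := s)) - f s (x(i := y))"]) auto
  have D0: "0 \<le> D i x" if x: "\<And>i. i \<in> {1..n} \<Longrightarrow> x i \<in> S" and i: "i \<in> {1..n}" for x i
    using D_ge[OF x i \<open>s \<in> S\<close>] by simp
  have deriv: "(G has_real_derivative (\<Sum>i=1..n. expn S (W t) n (D i) x0)) (at t)"
    if t: "0 \<le> t" "t \<le> \<epsilon>" for t
  proof -
    interpret positive_distribution S "W t" "1 / (2 * real m)" by (rule dist[OF t])
    show ?thesis unfolding G_def D_def
      by (rule Russo_formula) (auto simp: W[abs_def] intro!: derivative_eq_intros)
  qed
  have D_equal: "expn S (W t) n (D i) x0 = expn S (W t) n (D j) x0"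
    if t: "0 \<le> t" "t \<le> \<epsilon>" and ij: "i \<in> {1..n}" "j \<in> {1..n}" for t i j
  proof -
    interpret positive_distribution S "W t" "1 / (2 * real m)" by (rule dist[OF t])
    obtain \<tau> where \<tau>: "\<tau> permutes {1..n}" "\<tau> i = j" "\<And>x. x\<in>(\<Pi>\<^sub>E i\<in>{1..n}. S) \<Longrightarrow> R (x \<circ> \<tau>) = R x"
      using R_sym[OF ij] by blast
    have f_inv: "f s (x \<circ> \<tau>) = f s x" if "\<And>i. i \<in> {1..n} \<Longrightarrow> x i \<in> S" for x
    proof -
      have "restrict (x \<circ> \<tau>) {1..n} = restrict x {1..n} \<circ> \<tau>"
        using permutes_in_image[OF \<tau>(1)] permutes_not_in[OF \<tau>(1)] by (auto simp: fun_eq_iff restrict_def)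
      then show ?thesis using \<tau>(3)[OF restr[OF that]] by (simp add: f_def)
    qed
    have upd: "(x \<circ> \<tau>)(i := y) = x(j := y) \<circ> \<tau>" for x :: "nat \<Rightarrow> 'b" and y
      using permutes_inj[OF \<tau>(1)] \<tau>(2) by (auto simp: fun_eq_iff inj_eq)
    have "expn S (W t) n (D i) x0 = expn S (W t) n (D i) (x0 \<circ> \<tau>)" by (simp add: x0_def o_def)
    also have "\<dots> = expn S (W t) n (\<lambda>x. D i (x \<circ> \<tau>)) x0"
      using expn_permute_coordinates[OF \<tau>(1)] by simp
    also have "\<dots> = expn S (W t) n (D j) x0"
    proof (rule expn_cong_on)
      fix x :: "nat \<Rightarrow> 'b" assume x: "\<And>i. i \<in> {1..n} \<Longrightarrow> x i \<in> S"
      show "D i (x \<circ> \<tau>) = D j x"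
        unfolding D_alt upd
        using x S by (intro sum.cong refl arg_cong2[of _ _ _ _ minus] f_inv) auto
    qed
    finally show ?thesis .
  qed
  \<comment> \<open>Exchanging s and u preserves the uniform weights and, by neutrality, carries the
    event of value s to that of value u. All values in S thus have equal probability, and these sum
    to 1.\<close>
  have G0: "G 0 = 1 / real r"
  proof -
    interpret positive_distribution S "W 0" "1 / (2 * real m)" using \<epsilon> by (intro dist) auto
    have eq: "expn S (W 0) n (f u) x0 = G 0" if u: "u \<in> S" for u
    proof -
      define \<sigma> where "\<sigma> = Transposition.transpose s u"
      have \<sigma>: "\<sigma> permutes S" unfolding \<sigma>_def using \<open>s \<in> S\<close> u by (rule permutes_swap_id)
      have "G 0 = expn S (W 0) n (\<lambda>x. f u (\<sigma> \<circ> x)) x0"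
        unfolding G_def
      proof (rule expn_cong_on)
        fix x :: "nat \<Rightarrow> 'b" assume x: "\<And>i. i \<in> {1..n} \<Longrightarrow> x i \<in> S"
        have "restrict (\<sigma> \<circ> x) {1..n} = (\<lambda>i\<in>{1..n}. \<sigma> (restrict x {1..n} i))" by auto
        then have "R (restrict (\<sigma> \<circ> x) {1..n}) = \<sigma> (R (restrict x {1..n}))"
          using R_neutral[OF \<sigma> restr[OF x]] by simp
        then show "f s x = f u (\<sigma> \<circ> x)"
          by (simp add: f_def \<sigma>_def) (metis transpose_apply_first transpose_involutory)
      qed
      also have "\<dots> = expn S (W 0) n (f u) (\<sigma> \<circ> x0)"
        by (rule expn_permute_values[OF \<sigma>]) (simp add: W)
      also have "\<dots> = expn S (W 0) n (f u) x0"
        by (rule expn_start) (auto simp: f_def intro!: arg_cong[of _ _ R])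
      finally show ?thesis ..
    qed
    have "1 = expn S (W 0) n (\<lambda>x. \<Sum>u\<in>S. f u x) x0"
    proof -
      have "expn S (W 0) n (\<lambda>x. 1) x0 = expn S (W 0) n (\<lambda>x. \<Sum>u\<in>S. f u x) x0"
      proof (rule expn_cong_on)
        fix x :: "nat \<Rightarrow> 'b" assume x: "\<And>i. i \<in> {1..n} \<Longrightarrow> x i \<in> S"
        show "1 = (\<Sum>u\<in>S. f u x)" using R_in[OF restr[OF x]] S by (simp add: f_def of_bool_def)
      qed
      then show ?thesis by (simp add: expn_const)
    qed
    also have "\<dots> = (\<Sum>u\<in>S. G 0)" unfolding expn_sum by (intro sum.cong refl eq)
    finally show ?thesis using r2 by (simp add: r_def field_simps)
  qed
  assume "\<not> \<delta> \<le> expn S (W \<epsilon>) n (\<lambda>x. of_bool (R (restrict x {1..n}) = s)) (\<lambda>_. undefined)"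
  then have G\<epsilon>: "G \<epsilon> < \<delta>" by (simp add: G_def f_def[abs_def] x0_def)
  have "\<exists>t>0. t < \<epsilon> \<and> G \<epsilon> - G 0 = (\<epsilon> - 0) * (\<Sum>i=1..n. expn S (W t) n (D i) x0)"
    using \<epsilon> deriv by (intro MVT2) auto
  then obtain t where t: "0 < t" "t < \<epsilon>" and mvt: "G \<epsilon> - G 0 = \<epsilon> * (\<Sum>i=1..n. expn S (W t) n (D i) x0)"
    by auto
  \<comment> \<open>Traps G t between 1/m and \<delta> at the intermediate point t, so that the
    variance G t (1 - G t) there is at least \<open>v\<close>.\<close>
  have G_mono: "G a \<le> G b" if ab: "0 \<le> a" "a \<le> b" "b \<le> \<epsilon>" for a b
  proof (rule DERIV_nonneg_imp_nondecreasing[OF ab(2)])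
    fix u assume u: "a \<le> u" "u \<le> b"
    then have u': "0 \<le> u" "u \<le> \<epsilon>" using ab by auto
    interpret positive_distribution S "W u" "1 / (2 * real m)" by (rule dist[OF u'])
    have "0 \<le> expn S (W u) n (D i) x0" if i: "i \<in> {1..n}" for i
      using expn_mono_on[of n "\<lambda>x. 0" "D i" x0] D0 i by (simp add: expn_const)
    then show "\<exists>y. (G has_real_derivative y) (at u) \<and> 0 \<le> y"
      using deriv[OF u'] by (intro exI conjI) (auto intro!: sum_nonneg)
  qed
  interpret positive_distribution S "W t" "1 / (2 * real m)" using t by (intro dist) auto
  define b where "b = 1 / (\<epsilon> * real n)"
  have b0: "0 < b" using \<epsilon> n0 by (simp add: b_def)
  have Db: "expn S (W t) n (D i) x0 \<le> b" if i: "i \<in> {1..n}" for i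
  proof -
    have "real n * expn S (W t) n (D i) x0 = (\<Sum>j=1..n. expn S (W t) n (D i) x0)" by simp
    also have "\<dots> = (\<Sum>j=1..n. expn S (W t) n (D j) x0)"
      using t i by (intro sum.cong D_equal) auto
    finally have "\<epsilon> * (real n * expn S (W t) n (D i) x0) = G \<epsilon> - G 0" using mvt by simp
    also have "\<dots> \<le> 1" using G\<epsilon> \<delta> G0 r2 by (smt (verit) divide_nonneg_nonneg of_nat_0_le_iff)
    finally show ?thesis using \<epsilon> n0 by (simp add: b_def field_simps)
  qed
  \<comment> \<open>Both \<open>f s x\<close> and \<open>f s (x(i := y))\<close> lie below
    \<open>f s (x(i := s))\<close> by at most \<open>D i x\<close>, so they differ by at most
    \<open>D i x\<close>.\<close>
  have abs_le: "\<bar>f s x - avg S (W t) i (f s) x\<bar> \<le> D i x"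
    if x: "\<And>i. i \<in> {1..n} \<Longrightarrow> x i \<in> S" and i: "i \<in> {1..n}" for x i
  proof -
    have "f s x - avg S (W t) i (f s) x = (\<Sum>y\<in>S. W t y * (f s x - f s (x(i := y))))"
      by (simp add: avg_def right_diff_distrib sum_subtractf w_sum flip: sum_distrib_right)
    also have "\<bar>\<dots>\<bar> \<le> (\<Sum>y\<in>S. W t y * D i x)"
    proof (rule order_trans[OF sum_abs], rule sum_mono)
      fix y assume y: "y \<in> S"
      have "f s (x(i := s)) - f s (x(i := z)) \<le> D i x" "f s (x(i := z)) \<le> f s (x(i := s))"
        if "z \<in> S" for z
        by (rule D_ge f_mono, use x i that in auto)+
      from this[OF x[OF i]] this[OF y] have "\<bar>f s x - f s (x(i := y))\<bar> \<le> D i x" by simp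
      then show "\<bar>W t y * (f s x - f s (x(i := y)))\<bar> \<le> W t y * D i x"
        using w_nonneg[OF y] by (simp add: abs_mult mult_left_mono)
    qed
    also have "\<dots> = D i x" by (simp add: w_sum flip: sum_distrib_right)
    finally show ?thesis .
  qed
  \<comment> \<open>Values of absolute value at most 1 do not grow when squared, so the bound on the
    L1 influences also serves the quadratic terms of the Sobolev side.\<close>
  have sq_le: "(f s x - avg S (W t) i (f s) x)\<^sup>2 \<le> \<bar>f s x - avg S (W t) i (f s) x\<bar>" for x i
  proof -
    have "0 \<le> avg S (W t) i (f s) x" "avg S (W t) i (f s) x \<le> 1"
      using avg_mono[of "\<lambda>_. 0" "f s" i x] avg_mono[of "f s" "\<lambda>_. 1" i x] f01 by (simp_all add: avg_const)
    then have "\<bar>f s x - avg S (W t) i (f s) x\<bar> \<le> 1" using f01[of s x] by (simp add: abs_le_iff)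
    then show ?thesis by (metis abs_ge_zero mult_left_le power2_abs power2_eq_square)
  qed
  define V where "V = expn S (W t) n (\<lambda>x. (f s x)\<^sup>2) x0 - (expn S (W t) n (f s) x0)\<^sup>2"
  have V: "V = G t * (1 - G t)"
  proof -
    have "(\<lambda>x. (f s x)\<^sup>2) = f s" by (auto simp: f_def fun_eq_iff)
    then show ?thesis by (simp add: V_def G_def power2_eq_square algebra_simps)
  qed
  have "v \<le> V"
  proof -
    have "G t \<le> \<delta>" using G_mono[of t \<epsilon>] t G\<epsilon> by simp
    moreover have "1 / real m \<le> G t"
    proof -
      have "1 / real m \<le> 1 / real r" using r2 by (intro divide_left_mono) auto
      also have "\<dots> \<le> G t" using G_mono[of 0 t] t G0 by simp
      finally show ?thesis .
    qed
    ultimately have "1 / real m * (1 - \<delta>) \<le> G t * (1 - G t)"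
      using \<delta> by (intro mult_mono) (auto intro: order_trans[of _ "1 / real m"])
    then show ?thesis by (simp add: V v_def)
  qed
  have nb: "real n * b\<^sup>2 = 1 / (\<epsilon>\<^sup>2 * real n)" using n0 \<epsilon> by (simp add: b_def power2_eq_square field_simps)
  have "V * ln (V / (real n * b\<^sup>2)) \<le>
      4 / (1 / (2 * real m)) * (\<Sum>k=1..n. expn S (W t) n (\<lambda>x. (f s x - avg S (W t) k (f s) x)\<^sup>2) x0)"
  proof (rule Falik_Samorodnitsky[OF b0 _ V_def])
    show "0 < V" using v0 \<open>v \<le> V\<close> by simp
    fix i assume i: "i \<in> {1..n}"
    show "expn S (W t) n (\<lambda>x. \<bar>f s x - avg S (W t) i (f s) x\<bar>) x0 \<le> b"
      by (rule order_trans[OF expn_mono_on Db[OF i]]) (rule abs_le[OF _ i])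
  qed
  also have "\<dots> \<le> 4 / (1 / (2 * real m)) * (\<Sum>k=1..n. b)"
  proof (intro mult_left_mono sum_mono)
    fix i assume i: "i \<in> {1..n}"
    show "expn S (W t) n (\<lambda>x. (f s x - avg S (W t) i (f s) x)\<^sup>2) x0 \<le> b"
      by (rule order_trans[OF expn_mono_on Db[OF i]]) (rule order_trans[OF sq_le abs_le[OF _ i]])
  qed simp
  \<comment> \<open>Here n cancels, being the number of influences of size at most 1 / (\<epsilon>
    n); on the left it survives inside the logarithm.\<close>
  also have "\<dots> = 8 * real m / \<epsilon>" using n0 \<epsilon> by (simp add: b_def)
  finally have upper: "V * ln (V * \<epsilon>\<^sup>2 * real n) \<le> 8 * real m / \<epsilon>" by (simp add: nb mult.assoc)
  have big: "exp (8 * real m / (\<epsilon> * v)) < v * \<epsilon>\<^sup>2 * real n"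
    using n v0 \<epsilon> by (simp add: field_simps)
  also have "\<dots> \<le> V * \<epsilon>\<^sup>2 * real n" using \<open>v \<le> V\<close> n0 by (intro mult_right_mono) auto
  finally have lnV: "8 * real m / (\<epsilon> * v) < ln (V * \<epsilon>\<^sup>2 * real n)"
    by (metis exp_gt_zero less_trans ln_exp ln_less_cancel_iff)
  have "8 * real m / \<epsilon> = v * (8 * real m / (\<epsilon> * v))" using v0 by simp
  also have "\<dots> < v * ln (V * \<epsilon>\<^sup>2 * real n)" using lnV v0 by (rule mult_strict_left_mono)
  also have "\<dots> \<le> V * ln (V * \<epsilon>\<^sup>2 * real n)"
  proof (rule mult_right_mono[OF \<open>v \<le> V\<close>])
    have "0 \<le> 8 * real m / (\<epsilon> * v)" using \<epsilon> v0 by simp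
    then show "0 \<le> ln (V * \<epsilon>\<^sup>2 * real n)" using lnV by linarith
  qed
  finally show False using upper by simp
qed

section \<open>Distributions on linear orders\<close>

lemma rational_choice_eqI:
  assumes "linear_order_on X \<pi>" "z \<in> S" "\<And>y. y \<in> S \<Longrightarrow> (y, z) \<in> \<pi>"
  shows "rational_choice \<pi> S = z"
  unfolding rational_choice_def
  using assms by (intro the_equality) (auto simp: linear_order_on_def partial_order_on_def antisym_def)

lemma rational_choice_greatest:
  assumes "finite X" "linear_order_on X \<pi>" "S \<subseteq> X" "S \<noteq> {}"
  shows "rational_choice \<pi> S \<in> S \<and> (\<forall>y\<in>S. (y, rational_choice \<pi> S) \<in> \<pi>)"
proof -
  have "finite S" using assms finite_subset by blast
  from this assms(4,3) have "\<exists>z\<in>S. \<forall>y\<in>S. (y, z) \<in> \<pi>"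
  proof (induction S rule: finite_ne_induct)
    case (singleton x)
    then show ?case using assms(2)
      by (auto simp: linear_order_on_def partial_order_on_def preorder_on_def refl_on_def)
  next
    case (insert x S)
    then obtain z where z: "z \<in> S" "\<forall>y\<in>S. (y, z) \<in> \<pi>" by auto
    have \<pi>: "trans \<pi>" "total_on X \<pi>" "refl_on X \<pi>"
      using assms(2) by (auto simp: linear_order_on_def partial_order_on_def preorder_on_def)
    show ?case
    proof (cases "(x, z) \<in> \<pi>")
      case False
      have "x \<in> X" "z \<in> X" using insert.prems z(1) by auto
      with False have "(z, x) \<in> \<pi>" "(x, x) \<in> \<pi>" using \<pi>(2,3)
        unfolding total_on_def refl_on_def by metis+
      then show ?thesis using z(2) transD[OF \<pi>(1)] by blast
    qed (use z in auto)
  qed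
  then obtain z where "z \<in> S" "\<forall>y\<in>S. (y, z) \<in> \<pi>" by blast
  moreover from this have "rational_choice \<pi> S = z" by (intro rational_choice_eqI[OF assms(2)]) auto
  ultimately show ?thesis by simp
qed

lemma finite_linear_orders: "finite X \<Longrightarrow> finite (linear_orders X)"
  by (rule finite_subset[of _ "Pow (X \<times> X)"])
    (auto simp: linear_orders_def linear_order_on_def partial_order_on_def preorder_on_def)

lemma card_linear_orders_le:
  assumes "finite X" shows "card (linear_orders X) \<le> 2 ^ (card X * card X)"
proof -
  have "card (linear_orders X) \<le> card (Pow (X \<times> X))"
    using assms by (intro card_mono)
      (auto simp: linear_orders_def linear_order_on_def partial_order_on_def preorder_on_def)
  then show ?thesis using assms by (simp add: card_Pow card_cartesian_product)
qed

(* The head of the list is the greatest element. *)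
primrec list_order :: "'a list \<Rightarrow> 'a rel" where
  "list_order [] = {}"
| "list_order (a # l) = set (a # l) \<times> {a} \<union> list_order l"

lemma list_order_subset: "list_order l \<subseteq> set l \<times> set l"
  by (induction l) auto

lemma linear_order_on_list_order: "distinct l \<Longrightarrow> linear_order_on (set l) (list_order l)"
proof (induction l)
  case Nil
  then show ?case
    by (simp add: linear_order_on_def partial_order_on_def preorder_on_def refl_on_def trans_def
        antisym_def total_on_def)
next
  case (Cons a l)
  then have l: "linear_order_on (set l) (list_order l)" and a: "a \<notin> set l" by auto
  have sub: "x \<in> set l" "y \<in> set l" if "(x, y) \<in> list_order l" for x y
    using list_order_subset[of l] that by auto
  have lin: "refl_on (set l) (list_order l)" "trans (list_order l)" "antisym (list_order l)"
    "total_on (set l) (list_order l)"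
    using l by (simp_all add: linear_order_on_def partial_order_on_def preorder_on_def)
  have "refl_on (set (a # l)) (list_order (a # l))" using lin(1) by (auto simp: refl_on_def)
  moreover have "trans (list_order (a # l))"
    by (rule transI) (use a sub in \<open>auto dest: transD[OF lin(2)]\<close>)
  moreover have "antisym (list_order (a # l))"
    by (rule antisymI) (use a sub in \<open>auto dest: antisymD[OF lin(3)]\<close>)
  moreover have "total_on (set (a # l)) (list_order (a # l))"
    using lin(4) by (auto simp: total_on_def)
  ultimately show ?case
    using list_order_subset[of "a # l"]
    by (simp add: linear_order_on_def partial_order_on_def preorder_on_def)
qed

lemma rational_choice_list_order:
  assumes l: "distinct l" and S: "S \<subseteq> set l" "S \<noteq> {}"
  shows "rational_choice (list_order l) S = hd (filter (\<lambda>z. z \<in> S) l)"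
proof -
  have ne: "filter (\<lambda>z. z \<in> S) l \<noteq> []" using S by (auto simp: filter_empty_conv)
  have "(y, hd (filter (\<lambda>z. z \<in> S) l)) \<in> list_order l" if "y \<in> S" for y
    using S(1) that
  proof (induction l)
    case (Cons a l)
    show ?case
    proof (cases "a \<in> S")
      case False
      then have "S \<subseteq> set l" using Cons.prems by auto
      with Cons False show ?thesis by simp
    qed (use Cons.prems in auto)
  qed auto
  then show ?thesis
    using hd_in_set[OF ne] by (intro rational_choice_eqI[OF linear_order_on_list_order[OF l]]) auto
qed

lemma list_order_in_linear_orders: "distinct l \<Longrightarrow> set l = X \<Longrightarrow> list_order l \<in> linear_orders X"
  using linear_order_on_list_order by (auto simp: linear_orders_def)

lemma exists_order_with_choice:
  assumes "finite X" "S \<subseteq> X" "s \<in> S"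
  obtains \<pi> where "\<pi> \<in> linear_orders X" "rational_choice \<pi> S = s"
proof -
  obtain l where l: "set l = X - {s}" "distinct l" using assms finite_distinct_list[of "X - {s}"] by auto
  show thesis
  proof
    show "list_order (s # l) \<in> linear_orders X" using l assms by (intro list_order_in_linear_orders) auto
    show "rational_choice (list_order (s # l)) S = s"
      using l assms by (subst rational_choice_list_order) auto
  qed
qed

section \<open>Relabelling of alternatives\<close>

lemma in_transport_order:
  assumes "\<sigma> permutes X"
  shows "(\<sigma> a, \<sigma> b) \<in> transport_order \<sigma> \<pi> \<longleftrightarrow> (a, b) \<in> \<pi>"
  using permutes_inj[OF assms] by (auto simp: transport_order_def inj_eq)

lemma transport_order_in_linear_orders:
  assumes \<sigma>: "\<sigma> permutes X" and \<pi>: "\<pi> \<in> linear_orders X"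
  shows "transport_order \<sigma> \<pi> \<in> linear_orders X"
proof -
  define \<tau> where "\<tau> = inv_into UNIV \<sigma>"
  have \<tau>: "\<tau> permutes X" unfolding \<tau>_def using \<sigma> by (rule permutes_inv)
  have \<tau>_in: "\<tau> a \<in> X \<longleftrightarrow> a \<in> X" for a by (rule permutes_in_image[OF \<tau>])
  have \<tau>_eq: "\<tau> a = \<tau> b \<longleftrightarrow> a = b" for a b using permutes_inj[OF \<tau>] by (simp add: inj_eq)
  have "\<sigma> (\<tau> a) = a" for a unfolding \<tau>_def by (rule permutes_inverses[OF \<sigma>])
  then have iff: "(a, b) \<in> transport_order \<sigma> \<pi> \<longleftrightarrow> (\<tau> a, \<tau> b) \<in> \<pi>" for a b
    using in_transport_order[OF \<sigma>, of "\<tau> a" "\<tau> b" \<pi>] by simp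
  have lin: "\<pi> \<subseteq> X \<times> X" "refl_on X \<pi>" "trans \<pi>" "antisym \<pi>" "total_on X \<pi>"
    using \<pi> by (auto simp: linear_orders_def linear_order_on_def partial_order_on_def preorder_on_def)
  have "transport_order \<sigma> \<pi> \<subseteq> X \<times> X" using lin(1) by (auto simp: iff \<tau>_in dest: subsetD)
  moreover have "refl_on X (transport_order \<sigma> \<pi>)" using lin(2) by (simp add: refl_on_def iff \<tau>_in)
  moreover have "trans (transport_order \<sigma> \<pi>)" by (rule transI) (use lin(3) in \<open>auto simp: iff dest: transD\<close>)
  moreover have "antisym (transport_order \<sigma> \<pi>)"
    by (rule antisymI) (use lin(4) \<tau>_eq in \<open>auto simp: iff dest: antisymD\<close>)
  moreover have "total_on X (transport_order \<sigma> \<pi>)"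
    using lin(5) unfolding total_on_def iff by (metis \<tau>_in \<tau>_eq)
  ultimately show ?thesis
    by (simp add: linear_orders_def linear_order_on_def partial_order_on_def preorder_on_def)
qed

lemma rational_choice_transport_order:
  assumes "finite X" and \<sigma>: "\<sigma> permutes X" and \<pi>: "\<pi> \<in> linear_orders X"
    and \<sigma>\<pi>: "transport_order \<sigma> \<pi> \<in> linear_orders X" and S: "S \<subseteq> X" "S \<noteq> {}"
  shows "rational_choice (transport_order \<sigma> \<pi>) (\<sigma> ` S) = \<sigma> (rational_choice \<pi> S)"
proof (rule rational_choice_eqI)
  show "linear_order_on X (transport_order \<sigma> \<pi>)" using \<sigma>\<pi> by (simp add: linear_orders_def)
  have "rational_choice \<pi> S \<in> S \<and> (\<forall>y\<in>S. (y, rational_choice \<pi> S) \<in> \<pi>)"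
    using \<pi> by (intro rational_choice_greatest[OF \<open>finite X\<close> _ S]) (simp add: linear_orders_def)
  then show "\<sigma> (rational_choice \<pi> S) \<in> \<sigma> ` S"
    "\<And>y. y \<in> \<sigma> ` S \<Longrightarrow> (y, \<sigma> (rational_choice \<pi> S)) \<in> transport_order \<sigma> \<pi>"
    by (auto simp: in_transport_order[OF \<sigma>])
qed

text \<open>Linear in \<open>u\<close>, which may take negative values: corrections to a
  distribution can be built and measured separately before they are added to it.\<close>

definition mass_choosing :: "'a set \<Rightarrow> ('a rel \<Rightarrow> real) \<Rightarrow> 'a set \<Rightarrow> 'a \<Rightarrow> real" where
  "mass_choosing X u T z = (\<Sum>\<pi>\<in>linear_orders X. u \<pi> * of_bool (rational_choice \<pi> T = z))"

lemma mass_choosing_sum: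
  "mass_choosing X (\<lambda>\<pi>. \<Sum>i\<in>I. u i \<pi>) T z = (\<Sum>i\<in>I. mass_choosing X (u i) T z)"
  unfolding mass_choosing_def sum_distrib_right by (rule sum.swap)

lemma mass_choosing_diff:
  "mass_choosing X (\<lambda>\<pi>. u \<pi> - u' \<pi>) T z = mass_choosing X u T z - mass_choosing X u' T z"
  by (simp add: mass_choosing_def algebra_simps sum_subtractf)

lemma mass_choosing_point:
  "finite X \<Longrightarrow> p \<in> linear_orders X \<Longrightarrow>
    mass_choosing X (\<lambda>\<pi>. of_bool (\<pi> = p)) T z = of_bool (rational_choice p T = z)"
  unfolding mass_choosing_def using finite_linear_orders[of X]
  by (subst sum.cong[OF refl, of _ _ "\<lambda>\<pi>. if \<pi> = p then of_bool (rational_choice p T = z) else 0"])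
    auto

lemma sum_mass_choosing:
  assumes "finite X" "T \<subseteq> X" "T \<noteq> {}"
  shows "(\<Sum>z\<in>T. mass_choosing X u T z) = sum u (linear_orders X)"
proof -
  have "(\<Sum>z\<in>T. mass_choosing X u T z) =
      (\<Sum>\<pi>\<in>linear_orders X. \<Sum>z\<in>T. u \<pi> * of_bool (rational_choice \<pi> T = z))"
    unfolding mass_choosing_def by (rule sum.swap)
  also have "\<dots> = sum u (linear_orders X)"
  proof (rule sum.cong[OF refl])
    fix \<pi> assume "\<pi> \<in> linear_orders X"
    then have "rational_choice \<pi> T \<in> T"
      using rational_choice_greatest[OF assms(1) _ assms(2,3)] by (simp add: linear_orders_def)
    moreover have "(\<Sum>z\<in>T. u \<pi> * of_bool (rational_choice \<pi> T = z)) =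
        (\<Sum>z\<in>T. if rational_choice \<pi> T = z then u \<pi> else 0)"
      by (intro sum.cong) auto
    ultimately show "(\<Sum>z\<in>T. u \<pi> * of_bool (rational_choice \<pi> T = z)) = u \<pi>"
      using finite_subset[OF assms(2,1)] by simp
  qed
  finally show ?thesis .
qed

text \<open>Adding a multiple of \<open>u\<close> moves mass from y to x in the choice from S and
  disturbs no other set, which is what makes the laws of all sets independently adjustable. The size
  bound solves a recursion: at most 2^m smaller sets need correction, and 1 + 2^m K^(s-1) \<le> K^s
  for K = 2^m + 1 and s = card S.\<close>

lemma exists_isolating_weights:
  assumes X: "finite X" and S: "S \<subseteq> X" "x \<in> S" "y \<in> S" "x \<noteq> y"
  shows "\<exists>u. (\<forall>\<pi>. \<bar>u \<pi>\<bar> \<le> (2 ^ card X + 1) ^ card S) \<and>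
    (\<forall>T\<in>nonempty_subsets X. \<forall>z.
      mass_choosing X u T z = of_bool (T = S) * (of_bool (z = x) - of_bool (z = y)))"
  using S(1-3)
proof (induction "card S" arbitrary: S rule: less_induct)
  case less
  define K :: real where "K = 2 ^ card X + 1"
  have K1: "1 \<le> K" by (simp add: K_def)
  have finS: "finite S" using less.prems X finite_subset by blast
  define \<T> where "\<T> = {T. T \<subset> S \<and> x \<in> T \<and> y \<in> T}"
  have fin\<T>: "finite \<T>" unfolding \<T>_def by (rule finite_subset[of _ "Pow S"]) (use finS in auto)
  have "\<forall>T\<in>\<T>. \<exists>u. (\<forall>\<pi>. \<bar>u \<pi>\<bar> \<le> K ^ card T) \<and>
    (\<forall>T'\<in>nonempty_subsets X. \<forall>z.
      mass_choosing X u T' z = of_bool (T' = T) * (of_bool (z = x) - of_bool (z = y)))"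
    unfolding K_def using less.prems by (intro ballI less.hyps) (auto simp: \<T>_def psubset_card_mono finS)
  from bchoice[OF this] obtain U where U_le: "\<And>T \<pi>. T \<in> \<T> \<Longrightarrow> \<bar>U T \<pi>\<bar> \<le> K ^ card T"
    and U: "\<And>T T' z. T \<in> \<T> \<Longrightarrow> T' \<in> nonempty_subsets X \<Longrightarrow>
      mass_choosing X (U T) T' z = of_bool (T' = T) * (of_bool (z = x) - of_bool (z = y))"
    by metis
  obtain bs where bs: "set bs = X - S" "distinct bs" using X finite_distinct_list[of "X - S"] by auto
  obtain rs where rs: "set rs = S - {x, y}" "distinct rs"
    using finS finite_distinct_list[of "S - {x, y}"] by auto
  (* p and q choose differently exactly from the sets T with {x, y} <= T <= S; the proper subsets
     of S among them are corrected by the induction hypothesis. *)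
  define p where "p = list_order (bs @ x # y # rs)"
  define q where "q = list_order (bs @ y # x # rs)"
  have lists: "distinct (bs @ x # y # rs)" "set (bs @ x # y # rs) = X"
    "distinct (bs @ y # x # rs)" "set (bs @ y # x # rs) = X"
    using bs rs less.prems S(4) by auto
  have pq: "p \<in> linear_orders X" "q \<in> linear_orders X"
    unfolding p_def q_def by (intro list_order_in_linear_orders lists)+
  define u where "u \<pi> = of_bool (\<pi> = p) - of_bool (\<pi> = q) - (\<Sum>T\<in>\<T>. U T \<pi>)" for \<pi>
  have "mass_choosing X u T z = of_bool (T = S) * (of_bool (z = x) - of_bool (z = y))"
    if T: "T \<in> nonempty_subsets X" for T z
  proof -
    have T': "T \<subseteq> X" "T \<noteq> {}" using T by (auto simp: nonempty_subsets_def)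
    define e where "e = (of_bool (z = x) - of_bool (z = y) :: real)"
    have c: "rational_choice p T = hd (filter (\<lambda>z. z \<in> T) (bs @ x # y # rs))"
      "rational_choice q T = hd (filter (\<lambda>z. z \<in> T) (bs @ y # x # rs))"
      unfolding p_def q_def
      by (rule rational_choice_list_order; use T' lists in blast)+
    \<comment> \<open>If T is not contained in S, both orders find their choice in the common prefix
      \<open>bs\<close> and so agree.\<close>
    have bs_nil: "filter (\<lambda>z. z \<in> T) bs = [] \<longleftrightarrow> T \<subseteq> S" using bs T' by (auto simp: filter_empty_conv)
    have "of_bool (rational_choice p T = z) - of_bool (rational_choice q T = z) =
        of_bool (T \<subseteq> S \<and> x \<in> T \<and> y \<in> T) * e"
    proof (cases "T \<subseteq> S")
      case True
      then have "filter (\<lambda>z. z \<in> T) bs = []" using bs_nil by simp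
      then show ?thesis unfolding c e_def filter_append using True by auto
    next
      case False
      then have "filter (\<lambda>z. z \<in> T) bs \<noteq> []" using bs_nil by simp
      then show ?thesis unfolding c e_def filter_append using False by (simp add: hd_append2)
    qed
    moreover have "(\<Sum>T'\<in>\<T>. mass_choosing X (U T') T z) = of_bool (T \<in> \<T>) * e"
    proof -
      have "(\<Sum>T'\<in>\<T>. mass_choosing X (U T') T z) = (\<Sum>T'\<in>\<T>. if T = T' then e else 0)"
        using U[OF _ T, of _ z] by (intro sum.cong) (auto simp: e_def)
      then show ?thesis using fin\<T> by simp
    qed
    ultimately have "mass_choosing X u T z = of_bool (T \<subseteq> S \<and> x \<in> T \<and> y \<in> T) * e - of_bool (T \<in> \<T>) * e"
      unfolding u_def mass_choosing_diff mass_choosing_sum by (simp add: mass_choosing_point X pq)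
    also have "\<dots> = of_bool (T = S) * e"
    proof (cases "T = S")
      case True
      then show ?thesis using less.prems by (simp add: \<T>_def)
    next
      case False
      then have "T \<in> \<T> \<longleftrightarrow> T \<subseteq> S \<and> x \<in> T \<and> y \<in> T" by (simp add: \<T>_def psubset_eq)
      then show ?thesis using False by simp
    qed
    finally show ?thesis by (simp add: e_def)
  qed
  moreover have "\<bar>u \<pi>\<bar> \<le> K ^ card S" for \<pi>
  proof -
    have "card S \<noteq> 0" using less.prems(2) finS by auto
    then have s1: "card S = Suc (card S - 1)" by simp
    have "\<bar>u \<pi>\<bar> \<le> \<bar>of_bool (\<pi> = p) - of_bool (\<pi> = q)\<bar> + \<bar>\<Sum>T\<in>\<T>. U T \<pi>\<bar>"
      unfolding u_def by (rule abs_triangle_ineq4)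
    also have "\<dots> \<le> 1 + (\<Sum>T\<in>\<T>. K ^ (card S - 1))"
    proof (rule add_mono)
      show "\<bar>\<Sum>T\<in>\<T>. U T \<pi>\<bar> \<le> (\<Sum>T\<in>\<T>. K ^ (card S - 1))"
      proof (rule order_trans[OF sum_abs], rule sum_mono)
        fix T assume T: "T \<in> \<T>"
        then have "card T \<le> card S - 1" using psubset_card_mono[OF finS, of T] by (auto simp: \<T>_def)
        then have "K ^ card T \<le> K ^ (card S - 1)" using K1 by (rule power_increasing)
        with U_le[OF T, of \<pi>] show "\<bar>U T \<pi>\<bar> \<le> K ^ (card S - 1)" by linarith
      qed
    qed simp
    also have "\<dots> = 1 + real (card \<T>) * K ^ (card S - 1)" by simp
    also have "\<dots> \<le> K ^ (card S - 1) + (K - 1) * K ^ (card S - 1)"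
    proof (intro add_mono mult_right_mono)
      show "1 \<le> K ^ (card S - 1)" using K1 by simp
      have "card \<T> \<le> card (Pow X)"
        using X less.prems by (intro card_mono) (auto simp: \<T>_def)
      then have "real (card \<T>) \<le> real (card (Pow X))" by simp
      then show "real (card \<T>) \<le> K - 1" using X by (simp add: K_def card_Pow)
    qed (use K1 in simp)
    also have "\<dots> = K ^ card S" by (subst (3) s1) (simp add: algebra_simps)
    finally show ?thesis .
  qed
  ultimately show ?case unfolding K_def by blast
qed


text \<open>Relabelling by the transposition of z and z' is an involution on the linear orders; it
  maps T to itself and turns a choice of z' into a choice of z. Hence all elements of T have equal
  mass.\<close>

lemma mass_choosing_uniform:
  assumes X: "finite X" and T: "T \<subseteq> X" "z \<in> T"
  shows "mass_choosing X (\<lambda>\<pi>. 1 / card (linear_orders X)) T z = 1 / card T"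
proof -
  let ?u = "\<lambda>\<pi>. 1 / real (card (linear_orders X))"
  have L: "linear_orders X \<noteq> {}" using exists_order_with_choice[OF X T] by blast
  have T0: "finite T" "T \<noteq> {}" using X T finite_subset by auto
  have eq: "mass_choosing X ?u T z' = mass_choosing X ?u T z" if z': "z' \<in> T" for z'
  proof -
    define \<sigma> where "\<sigma> = Transposition.transpose z z'"
    have \<sigma>T: "\<sigma> permutes T" unfolding \<sigma>_def using T(2) z' by (rule permutes_swap_id)
    then have \<sigma>: "\<sigma> permutes X" using T(1) by (rule permutes_subset)
    have inv: "transport_order \<sigma> (transport_order \<sigma> \<pi>) = \<pi>" for \<pi>
      by (simp add: transport_order_def image_image case_prod_unfold map_prod_def \<sigma>_def)
    have choice: "rational_choice (transport_order \<sigma> \<pi>) T = \<sigma> (rational_choice \<pi> T)"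
      if "\<pi> \<in> linear_orders X" for \<pi>
      using rational_choice_transport_order[OF X \<sigma> that transport_order_in_linear_orders[OF \<sigma> that] T(1) T0(2)]
        permutes_image[OF \<sigma>T] by simp
    show ?thesis unfolding mass_choosing_def
    proof (rule sum.reindex_bij_witness[of _ "transport_order \<sigma>" "transport_order \<sigma>"])
      fix \<pi> assume \<pi>: "\<pi> \<in> linear_orders X"
      have "\<sigma> a = z \<longleftrightarrow> a = z'" for a unfolding \<sigma>_def by (metis transpose_apply_second transpose_involutory)
      then show "?u (transport_order \<sigma> \<pi>) * of_bool (rational_choice (transport_order \<sigma> \<pi>) T = z) =
          ?u \<pi> * of_bool (rational_choice \<pi> T = z')"
        by (simp add: choice[OF \<pi>])
    qed (use inv transport_order_in_linear_orders[OF \<sigma>] in auto)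
  qed
  have "real (card T) * mass_choosing X ?u T z = (\<Sum>z'\<in>T. mass_choosing X ?u T z')"
    by (subst sum.cong[OF refl eq]) simp_all
  also have "\<dots> = sum ?u (linear_orders X)" by (rule sum_mass_choosing[OF X T(1) T0(2)])
  also have "\<dots> = 1" using L finite_linear_orders[OF X] by simp
  finally show ?thesis using T0 by (simp add: field_simps)
qed

(* Small enough for the perturbed weights in exists_biased_distribution to be nonnegative. *)
definition bias :: "nat \<Rightarrow> real" where
  "bias m = 1 / (2 * 2 ^ (m * m) * (2 ^ m * (real m + 1) * (2 ^ m + 1) ^ m))"

lemma bias_pos: "0 < bias m"
proof -
  have "0 < (2 ^ m + 1 :: real)" by (simp add: add_pos_pos)
  then show ?thesis by (simp add: bias_def)
qed

text \<open>Meets the condition on \<epsilon> in \<open>sharp_threshold\<close>, where it keeps the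
  atoms of the choice laws at least 1/(2m).\<close>

lemma bias_le: 
  assumes "0 < m"
  shows "bias m \<le> 1 / (2 * real m)"
proof -
  have "1 * real m \<le> (2 ^ (m * m) * (2 ^ m * (2 ^ m + 1) ^ m)) * (real m + 1)"
  proof (rule mult_mono)
    have "1 \<le> (2 ^ m + 1 :: real) ^ m" by (rule one_le_power) simp
    then have "1 * 1 \<le> (2 ^ m :: real) * (2 ^ m + 1) ^ m" by (intro mult_mono) auto
    then have "1 * (1 * 1) \<le> (2 ^ (m * m) :: real) * (2 ^ m * (2 ^ m + 1) ^ m)" by (intro mult_mono) auto
    then show "1 \<le> (2 ^ (m * m) :: real) * (2 ^ m * (2 ^ m + 1) ^ m)" by simp
  qed auto
  then have "2 * real m \<le> 2 * 2 ^ (m * m) * (2 ^ m * (real m + 1) * (2 ^ m + 1) ^ m)"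
    by (simp add: algebra_simps)
  moreover have "0 < (2 ^ m + 1 :: real)" by (simp add: add_pos_pos)
  ultimately show ?thesis unfolding bias_def using assms by (intro divide_left_mono) auto
qed

lemma exists_pmf_of_weights:
  assumes "finite A" "\<And>a. a \<in> A \<Longrightarrow> 0 \<le> p a" "sum p A = 1"
  obtains \<nu> where "set_pmf \<nu> \<subseteq> A" "\<And>a. a \<in> A \<Longrightarrow> pmf \<nu> a = p a"
proof -
  define f where "f a = (if a \<in> A then p a else 0)" for a
  have f0: "0 \<le> f a" for a using assms by (simp add: f_def)
  have "(\<integral>\<^sup>+a. ennreal (f a) \<partial>count_space UNIV) = (\<Sum>a\<in>A. ennreal (f a))"
    using assms(1) by (intro nn_integral_count_space') (auto simp: f_def)
  also have "\<dots> = ennreal (sum p A)" using f0 by (subst sum_ennreal) (auto simp: f_def intro!: arg_cong[of _ _ ennreal] assms(2))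
  finally have 1: "(\<integral>\<^sup>+a. ennreal (f a) \<partial>count_space UNIV) = 1" using assms by simp
  show thesis
  proof
    show "set_pmf (embed_pmf f) \<subseteq> A" by (auto simp: set_embed_pmf[OF f0 1] f_def)
    show "pmf (embed_pmf f) a = p a" if "a \<in> A" for a using that by (simp add: pmf_embed_pmf[OF f0 1] f_def)
  qed
qed

lemma finite_nonempty_subsets: "finite X \<Longrightarrow> finite (nonempty_subsets X)"
  by (rule finite_subset[of _ "Pow X"]) (auto simp: nonempty_subsets_def)

lemma card_nonempty_subsets_le: "finite X \<Longrightarrow> card (nonempty_subsets X) \<le> 2 ^ card X"
  using card_mono[of "Pow X" "nonempty_subsets X"] by (auto simp: nonempty_subsets_def card_Pow)

text \<open>For every S and every y in S other than c0 S, isolating weights move one unit from y to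
  c0 S. Altogether c0 S gains card S - 1 and each other element of S loses 1; scaled by
  \<open>bias\<close>, the sum of these corrections is small enough to be added to the uniform
  weights.\<close>

lemma exists_biased_distribution:
  assumes X: "finite X" and c0: "choice_function X c0"
  obtains \<nu> where "set_pmf \<nu> \<subseteq> linear_orders X"
    and "\<And>T z. T \<in> nonempty_subsets X \<Longrightarrow> z \<in> T \<Longrightarrow>
      pmf (map_pmf (\<lambda>\<pi>. rational_choice \<pi> T) \<nu>) z =
        1 / real (card T) + bias (card X) * (real (card T) * of_bool (z = c0 T) - 1)"
proof -
  let ?m = "card X" and ?L = "linear_orders X"
  define K :: real where "K = 2 ^ ?m + 1"
  have K1: "1 \<le> K" by (simp add: K_def)
  have finL: "finite ?L" using X by (rule finite_linear_orders)
  have c0_in: "c0 S \<in> S" if "S \<in> nonempty_subsets X" for S using c0 that by (simp add: choice_function_def)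
  have fin: "finite S" if "S \<in> nonempty_subsets X" for S
    using X that finite_subset by (auto simp: nonempty_subsets_def)
  have "\<forall>i\<in>(SIGMA S:nonempty_subsets X. S - {c0 S}). \<exists>u. (\<forall>\<pi>. \<bar>u \<pi>\<bar> \<le> K ^ card (fst i)) \<and>
    (\<forall>T\<in>nonempty_subsets X. \<forall>z.
      mass_choosing X u T z = of_bool (T = fst i) * (of_bool (z = c0 (fst i)) - of_bool (z = snd i)))"
    unfolding K_def
    by (intro ballI exists_isolating_weights[OF X]) (auto simp: nonempty_subsets_def intro: c0_in)
  from bchoice[OF this] obtain U where
    U_le: "\<And>S y \<pi>. S \<in> nonempty_subsets X \<Longrightarrow> y \<in> S - {c0 S} \<Longrightarrow> \<bar>U (S, y) \<pi>\<bar> \<le> K ^ card S" and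
    U: "\<And>S y T z. S \<in> nonempty_subsets X \<Longrightarrow> y \<in> S - {c0 S} \<Longrightarrow> T \<in> nonempty_subsets X \<Longrightarrow>
      mass_choosing X (U (S, y)) T z = of_bool (T = S) * (of_bool (z = c0 S) - of_bool (z = y))"
    by fastforce
  define V where "V \<pi> = (\<Sum>S\<in>nonempty_subsets X. \<Sum>y\<in>S - {c0 S}. U (S, y) \<pi>)" for \<pi>
  have V: "mass_choosing X V T z = real (card T) * of_bool (z = c0 T) - 1"
    if T: "T \<in> nonempty_subsets X" and z: "z \<in> T" for T z
  proof -
    have "mass_choosing X V T z = (\<Sum>S\<in>nonempty_subsets X. \<Sum>y\<in>S - {c0 S}. mass_choosing X (U (S, y)) T z)"
      unfolding V_def mass_choosing_sum ..
    also have "\<dots> = (\<Sum>S\<in>nonempty_subsets X. \<Sum>y\<in>S - {c0 S}.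
        of_bool (T = S) * (of_bool (z = c0 S) - of_bool (z = y)))"
      using U[OF _ _ T] by (intro sum.cong refl) auto
    also have "\<dots> = (\<Sum>S\<in>nonempty_subsets X. if T = S then
        (\<Sum>y\<in>S - {c0 S}. of_bool (z = c0 S) - of_bool (z = y)) else 0)"
      by (intro sum.cong) auto
    also have "\<dots> = (\<Sum>y\<in>T - {c0 T}. of_bool (z = c0 T) - of_bool (z = y))"
      using T finite_nonempty_subsets[OF X] by simp
    \<comment> \<open>The term for y = c0 T is zero; it is restored so that the sum runs over all of
      T.\<close>
    also have "\<dots> = (\<Sum>y\<in>T. of_bool (z = c0 T) - of_bool (z = y)) - (of_bool (z = c0 T) - of_bool (z = c0 T))"
      using fin[OF T] c0_in[OF T] by (subst sum.remove[of T "c0 T"]) auto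
    also have "(\<Sum>y\<in>T. of_bool (z = y)) = (1 :: real)"
    proof -
      have "(\<Sum>y\<in>T. of_bool (z = y)) = (\<Sum>y\<in>T. if z = y then 1 else (0 :: real))" by (intro sum.cong) auto
      then show ?thesis using fin[OF T] z by simp
    qed
    then have "(\<Sum>y\<in>T. of_bool (z = c0 T) - of_bool (z = y)) - (of_bool (z = c0 T) - of_bool (z = c0 T)) =
        real (card T) * of_bool (z = c0 T) - (1 :: real)"
      by (simp add: sum_subtractf)
    finally show ?thesis .
  qed
  \<comment> \<open>The total weight is the sum of the masses of all choices from X, where gains and
    losses cancel.\<close>
  have V_sum: "sum V ?L = 0"
  proof (cases "X = {}")
    case True
    then show ?thesis by (simp add: V_def nonempty_subsets_def)
  next
    case False
    then have XX: "X \<in> nonempty_subsets X" by (simp add: nonempty_subsets_def)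
    have "sum V ?L = (\<Sum>z\<in>X. mass_choosing X V X z)" using sum_mass_choosing[OF X _ False] by simp
    also have "\<dots> = (\<Sum>z\<in>X. real (card X) * of_bool (z = c0 X) - 1)" using V[OF XX] by (intro sum.cong) auto
    also have "\<dots> = real (card X) * (\<Sum>z\<in>X. if z = c0 X then 1 else (0::real)) - real (card X)"
      by (simp add: sum_subtractf sum_distrib_left of_bool_def)
    also have "\<dots> = 0" using X c0_in[OF XX] by simp
    finally show ?thesis .
  qed
  \<comment> \<open>At most 2^m sets, fewer than m + 1 elements y for each, and weights of size at
    most K^m. The + 1 keeps M positive even for empty X.\<close>
  define M where "M = 2 ^ ?m * (real ?m + 1) * K ^ ?m"
  have V_le: "\<bar>V \<pi>\<bar> \<le> M" for \<pi>
  proof -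
    have "\<bar>V \<pi>\<bar> \<le> (\<Sum>S\<in>nonempty_subsets X. \<bar>\<Sum>y\<in>S - {c0 S}. U (S, y) \<pi>\<bar>)"
      unfolding V_def by (rule sum_abs)
    also have "\<dots> \<le> (\<Sum>S\<in>nonempty_subsets X. (real ?m + 1) * K ^ ?m)"
    proof (rule sum_mono)
      fix S assume S: "S \<in> nonempty_subsets X"
      then have cS: "card S \<le> ?m" using X card_mono by (auto simp: nonempty_subsets_def)
      have "\<bar>\<Sum>y\<in>S - {c0 S}. U (S, y) \<pi>\<bar> \<le> (\<Sum>y\<in>S - {c0 S}. K ^ ?m)"
      proof (rule order_trans[OF sum_abs], rule sum_mono)
        fix y assume "y \<in> S - {c0 S}"
        then show "\<bar>U (S, y) \<pi>\<bar> \<le> K ^ ?m"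
          using U_le[OF S, of y \<pi>] power_increasing[OF cS K1] by linarith
      qed
      also have "\<dots> = real (card (S - {c0 S})) * K ^ ?m" by simp
      also have "\<dots> \<le> (real ?m + 1) * K ^ ?m"
        using cS card_Diff1_le[of S "c0 S"] K1 by (intro mult_right_mono) auto
      finally show "\<bar>\<Sum>y\<in>S - {c0 S}. U (S, y) \<pi>\<bar> \<le> (real ?m + 1) * K ^ ?m" .
    qed
    also have "\<dots> = real (card (nonempty_subsets X)) * ((real ?m + 1) * K ^ ?m)" by simp
    also have "\<dots> \<le> 2 ^ ?m * ((real ?m + 1) * K ^ ?m)"
    proof (rule mult_right_mono)
      have "real (card (nonempty_subsets X)) \<le> real (2 ^ ?m)"
        using card_nonempty_subsets_le[OF X] by (simp only: of_nat_le_iff)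
      then show "real (card (nonempty_subsets X)) \<le> 2 ^ ?m" by simp
    qed (use K1 in simp)
    finally show ?thesis by (simp add: M_def mult.assoc)
  qed
  have M0: "0 < M" using K1 by (auto simp: M_def intro!: mult_pos_pos add_nonneg_pos)
  have bias: "bias ?m = 1 / (2 * 2 ^ (?m * ?m) * M)" by (simp add: bias_def M_def K_def)
  define p where "p \<pi> = 1 / card ?L + bias ?m * V \<pi>" for \<pi>
  have L0: "?L \<noteq> {}"
  proof -
    obtain l where "set l = X" "distinct l" using finite_distinct_list[OF X] by auto
    then show ?thesis using list_order_in_linear_orders[of l X] by auto
  qed
  have p0: "0 \<le> p \<pi>" for \<pi>
  proof -
    have "\<bar>bias ?m * V \<pi>\<bar> = bias ?m * \<bar>V \<pi>\<bar>" using bias_pos[of ?m] by (simp add: abs_mult)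
    also have "\<dots> \<le> bias ?m * M" using bias_pos[of ?m] V_le by (intro mult_left_mono) auto
    also have "\<dots> = 1 / (2 * 2 ^ (?m * ?m))" using M0 by (simp add: bias)
    \<comment> \<open>A linear order is a subset of X \<times> X, so there are at most 2^(m^2) of
      them.\<close>
    also have "\<dots> \<le> 1 / card ?L"
    proof (rule divide_left_mono)
      have "real (card ?L) \<le> 2 ^ (?m * ?m)"
        using of_nat_mono[OF card_linear_orders_le[OF X], where 'a = real]
        by (simp only: of_nat_power of_nat_numeral)
      moreover have "0 \<le> (2 :: real) ^ (?m * ?m)" by simp
      ultimately show "real (card ?L) \<le> 2 * 2 ^ (?m * ?m)" by linarith
    qed (use L0 finL in \<open>auto simp: card_gt_0_iff\<close>)
    finally show ?thesis by (simp add: p_def abs_le_iff)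
  qed
  have "sum p ?L = 1" using V_sum L0 finL by (simp add: p_def sum.distrib flip: sum_distrib_left)
  then obtain \<nu> where \<nu>: "set_pmf \<nu> \<subseteq> ?L" "\<And>\<pi>. \<pi> \<in> ?L \<Longrightarrow> pmf \<nu> \<pi> = p \<pi>"
    using exists_pmf_of_weights[OF finL, of p] p0 by blast
  show thesis
  proof
    show "set_pmf \<nu> \<subseteq> ?L" by (rule \<nu>)
    fix T z assume T: "T \<in> nonempty_subsets X" and z: "z \<in> T"
    have "pmf (map_pmf (\<lambda>\<pi>. rational_choice \<pi> T) \<nu>) z =
        measure_pmf.prob \<nu> {\<pi>\<in>?L. rational_choice \<pi> T = z}"
      unfolding pmf_map using \<nu>(1)
      by (intro measure_prob_cong_0) (auto simp: pmf_eq_0_set_pmf)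
    also have "\<dots> = (\<Sum>\<pi>\<in>{\<pi>\<in>?L. rational_choice \<pi> T = z}. pmf \<nu> \<pi>)"
      using finL by (intro measure_measure_pmf_finite) simp
    also have "\<dots> = (\<Sum>\<pi>\<in>?L. p \<pi> * of_bool (rational_choice \<pi> T = z))"
      using finL \<nu>(2) by (intro sum.mono_neutral_cong_left) auto
    also have "\<dots> = mass_choosing X (\<lambda>\<pi>. 1 / card ?L) T z + bias ?m * mass_choosing X V T z"
      by (simp add: mass_choosing_def p_def algebra_simps sum.distrib sum_distrib_left)
    also have "\<dots> = 1 / real (card T) + bias ?m * (real (card T) * of_bool (z = c0 T) - 1)"
      using mass_choosing_uniform[OF X _ z] V[OF T z] T by (simp add: nonempty_subsets_def)
    finally show "pmf (map_pmf (\<lambda>\<pi>. rational_choice \<pi> T) \<nu>) z =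
        1 / real (card T) + bias ?m * (real (card T) * of_bool (z = c0 T) - 1)" .
  qed
qed

section \<open>Social choice functions\<close>

text \<open>Independent orders make independent choices: the image of the product distribution under
  \<open>h\<close> in each coordinate is the product of the marginals, whose expectation is an
  explicit finite sum. The tuple \<open>x0\<close> is arbitrary because \<open>P\<close> sees only
  the restriction to {1..n}.\<close>

lemma (in finite_distribution) prob_Pi_pmf_eq_expn:
  assumes h: "\<And>y. y \<in> S \<Longrightarrow> pmf (map_pmf h \<nu>) y = w y"
  shows "measure_pmf.prob (Pi_pmf {1..n} undefined (\<lambda>_. \<nu>)) {\<pi>. P (\<lambda>i\<in>{1..n}. h (\<pi> i))} =
    expn S w n (\<lambda>x. of_bool (P (restrict x {1..n}))) x0"
proof -
  let ?Q = "Pi_pmf {1..n} undefined (\<lambda>_. map_pmf h \<nu>)"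
  let ?P = "\<Pi>\<^sub>E i\<in>{1..n}. S"
  have fin: "finite ?P" using finite_S by (intro finite_PiE) auto
  have supp: "set_pmf (map_pmf h \<nu>) \<subseteq> S"
  proof -
    have "measure_pmf.prob (map_pmf h \<nu>) S = 1"
      by (subst measure_measure_pmf_finite[OF finite_S], subst sum.cong[OF refl h]) (simp_all add: w_sum)
    then show ?thesis using finite_S by (auto simp: measure_pmf.prob_eq_1 AE_measure_pmf_iff)
  qed
  \<comment> \<open>Applying \<open>h\<close> turns the default value \<open>undefined\<close> into
    \<open>h undefined\<close>, whereas restricted tuples need \<open>undefined\<close> outside
    {1..n}.\<close>
  have "?Q = map_pmf (\<lambda>f x. if x \<in> {1..n} then f x else undefined)
      (Pi_pmf {1..n} (h undefined) (\<lambda>_. map_pmf h \<nu>))"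
    by (rule Pi_pmf_default_swap[symmetric]) simp
  also have "Pi_pmf {1..n} (h undefined) (\<lambda>_. map_pmf h \<nu>) =
      map_pmf (\<lambda>g. h \<circ> g) (Pi_pmf {1..n} undefined (\<lambda>_. \<nu>))"
    by (rule Pi_pmf_map) simp_all
  finally have Q: "?Q = map_pmf (\<lambda>\<pi>. \<lambda>i\<in>{1..n}. h (\<pi> i)) (Pi_pmf {1..n} undefined (\<lambda>_. \<nu>))"
    by (simp add: map_pmf_comp restrict_def o_def)
  have "measure_pmf.prob (Pi_pmf {1..n} undefined (\<lambda>_. \<nu>)) {\<pi>. P (\<lambda>i\<in>{1..n}. h (\<pi> i))} =
      measure_pmf.prob ?Q {x. P x}"
    unfolding Q by (simp add: vimage_def)
  also have "\<dots> = measure_pmf.prob ?Q {x\<in>?P. P x}"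
  proof (rule measure_prob_cong_0)
    fix x assume "x \<in> {x. P x} - {x\<in>?P. P x}"
    then have "x \<notin> ?P" by blast
    moreover have "set_pmf ?Q \<subseteq> ?P"
      using supp by (subst set_Pi_pmf) (auto simp: PiE_dflt_def)
    ultimately show "pmf ?Q x = 0" by (auto simp: pmf_eq_0_set_pmf)
  qed auto
  also have "\<dots> = (\<Sum>z\<in>{x\<in>?P. P x}. pmf ?Q z)" using fin by (intro measure_measure_pmf_finite) simp
  also have "\<dots> = (\<Sum>z\<in>?P. (\<Prod>i\<in>{1..n}. w (z i)) * of_bool (P z))"
  proof (rule sum.mono_neutral_cong_left[OF fin])
    fix z assume z: "z \<in> {x\<in>?P. P x}"
    then have "pmf ?Q z = (\<Prod>i\<in>{1..n}. pmf (map_pmf h \<nu>) (z i))"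
      by (intro pmf_Pi') (auto simp: PiE_def extensional_def)
    also have "\<dots> = (\<Prod>i\<in>{1..n}. w (z i))" using z by (intro prod.cong refl h) auto
    finally show "pmf ?Q z = (\<Prod>i\<in>{1..n}. w (z i)) * of_bool (P z)" using z by simp
  qed auto
  also have "\<dots> = expn S w n (\<lambda>x. of_bool (P (restrict x {1..n}))) x0"
    unfolding expn_eq_sum
  proof (rule sum.cong[OF refl])
    fix z assume "z \<in> ?P"
    then have "restrict (\<lambda>i. if i \<in> {1..n} then z i else x0 i) {1..n} = z"
      by (auto simp: fun_eq_iff PiE_def extensional_def)
    then show "(\<Prod>i\<in>{1..n}. w (z i)) * of_bool (P z) = (\<Prod>i\<in>{1..n}. w (z i)) *
        of_bool (P (restrict (\<lambda>i. if i \<in> {1..n} then z i else x0 i) {1..n}))" by simp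
  qed
  finally show ?thesis .
qed

text \<open>Through this the symmetries of F, which speak of profiles, carry over to every argument
  of the local rule in S^n.\<close>

lemma exists_profile_with_choices:
  assumes "finite X" "S \<subseteq> X" "x \<in> (\<Pi>\<^sub>E i\<in>{1..n}. S)"
  obtains \<pi> where "\<pi> \<in> profiles n X" "individual_choices n \<pi> S = x"
proof -
  have "\<forall>i\<in>{1..n}. \<exists>\<pi>. \<pi> \<in> linear_orders X \<and> rational_choice \<pi> S = x i"
  proof
    fix i assume "i \<in> {1..n}"
    then have "x i \<in> S" using assms(3) by auto
    then show "\<exists>\<pi>. \<pi> \<in> linear_orders X \<and> rational_choice \<pi> S = x i"
      using exists_order_with_choice[OF assms(1,2)] by metis
  qed
  from bchoice[OF this] obtain p where p: "\<forall>i\<in>{1..n}. p i \<in> linear_orders X \<and> rational_choice (p i) S = x i" by auto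
  show thesis
  proof
    show "restrict p {1..n} \<in> profiles n X" using p by (auto simp: profiles_def)
    show "individual_choices n (restrict p {1..n}) S = x"
      using p assms(3) by (auto simp: individual_choices_def fun_eq_iff PiE_def extensional_def)
  qed
qed

text \<open>A permutation of S fixes the rest of X, so it is a permutation of X mapping S to itself,
  and neutrality relates the rule for S to itself.\<close>

lemma local_rule_neutral:
  assumes X: "finite X" and S: "S \<in> nonempty_subsets X" and R: "local_rule n X F S R"
    and F: "neutral n X F" and \<sigma>: "\<sigma> permutes S" and x: "x \<in> (\<Pi>\<^sub>E i\<in>{1..n}. S)"
  shows "R (\<lambda>i\<in>{1..n}. \<sigma> (x i)) = \<sigma> (R x)"
proof -
  have SX: "S \<subseteq> X" "S \<noteq> {}" using S by (auto simp: nonempty_subsets_def)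
  have \<sigma>X: "\<sigma> permutes X" using \<sigma> SX(1) by (rule permutes_subset)
  obtain \<pi> where \<pi>: "\<pi> \<in> profiles n X" "individual_choices n \<pi> S = x"
    using exists_profile_with_choices[OF X SX(1) x] by blast
  have \<pi>i: "\<pi> i \<in> linear_orders X" if "i \<in> {1..n}" for i using \<pi>(1) that by (auto simp: profiles_def)
  define \<pi>' where "\<pi>' = (\<lambda>i\<in>{1..n}. transport_order \<sigma> (\<pi> i))"
  have \<pi>': "\<pi>' \<in> profiles n X"
    using \<pi>i transport_order_in_linear_orders[OF \<sigma>X] by (auto simp: profiles_def \<pi>'_def)
  have "individual_choices n \<pi>' S = (\<lambda>i\<in>{1..n}. \<sigma> (x i))"
  proof -
    have "rational_choice (transport_order \<sigma> (\<pi> i)) S = \<sigma> (x i)" if i: "i \<in> {1..n}" for i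
    proof -
      have "x i = rational_choice (\<pi> i) S" using \<pi>(2) i by (auto simp: individual_choices_def)
      then show ?thesis
        using rational_choice_transport_order[OF X \<sigma>X \<pi>i[OF i] transport_order_in_linear_orders[OF \<sigma>X \<pi>i[OF i]] SX]
          permutes_image[OF \<sigma>] by simp
    qed
    then show ?thesis by (auto simp: individual_choices_def \<pi>'_def)
  qed
  then have "R (\<lambda>i\<in>{1..n}. \<sigma> (x i)) = F \<pi>' S" using R \<pi>' by (simp add: local_rule_def)
  also have "\<dots> = \<sigma> (F \<pi> S)"
    using F \<pi>(1) S \<sigma>X permutes_image[OF \<sigma>] unfolding neutral_def \<pi>'_def by metis
  also have "F \<pi> S = R x" using R \<pi> by (simp add: local_rule_def)
  finally show ?thesis .
qed

lemma local_rule_weakly_anonymous: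
  assumes X: "finite X" and S: "S \<in> nonempty_subsets X" and R: "local_rule n X F S R"
    and F: "weakly_anonymous n X F" and ij: "i \<in> {1..n}" "j \<in> {1..n}"
  shows "\<exists>\<tau>. \<tau> permutes {1..n} \<and> \<tau> i = j \<and> (\<forall>x\<in>(\<Pi>\<^sub>E i\<in>{1..n}. S). R (x \<circ> \<tau>) = R x)"
proof -
  obtain G where G: "subgroup G (sym_group n)" "\<exists>\<tau>\<in>G. \<tau> i = j"
    "\<And>\<tau> \<pi>. \<tau> \<in> G \<Longrightarrow> \<pi> \<in> profiles n X \<Longrightarrow> F (\<lambda>i. \<pi> (\<tau> i)) S = F \<pi> S"
    using F S ij unfolding weakly_anonymous_def by blast
  obtain \<tau> where \<tau>: "\<tau> \<in> G" "\<tau> i = j" using G(2) by blast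
  have perm: "\<tau> permutes {1..n}" using subgroup.subset[OF G(1)] \<tau>(1) by (auto simp: sym_group_def)
  have "R (x \<circ> \<tau>) = R x" if x: "x \<in> (\<Pi>\<^sub>E i\<in>{1..n}. S)" for x
  proof -
    obtain \<pi> where \<pi>: "\<pi> \<in> profiles n X" "individual_choices n \<pi> S = x"
      using exists_profile_with_choices[OF X _ x] S by (auto simp: nonempty_subsets_def)
    have \<pi>': "(\<lambda>i. \<pi> (\<tau> i)) \<in> profiles n X"
      using \<pi>(1) permutes_in_image[OF perm] by (auto simp: profiles_def PiE_def Pi_def extensional_def)
    have "individual_choices n (\<lambda>i. \<pi> (\<tau> i)) S = x \<circ> \<tau>"
      using \<pi>(2)[symmetric] permutes_in_image[OF perm] by (auto simp: individual_choices_def fun_eq_iff restrict_def)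
    then have "R (x \<circ> \<tau>) = F (\<lambda>i. \<pi> (\<tau> i)) S" using R \<pi>' by (simp add: local_rule_def)
    also have "\<dots> = F \<pi> S" by (rule G(3)[OF \<tau>(1) \<pi>(1)])
    also have "\<dots> = R x" using R \<pi> by (simp add: local_rule_def)
    finally show ?thesis .
  qed
  with perm \<tau>(2) show ?thesis by blast
qed

lemma set_Pi_pmf_profiles:
  "set_pmf \<nu> \<subseteq> linear_orders X \<Longrightarrow> set_pmf (Pi_pmf {1..n} undefined (\<lambda>_. \<nu>)) \<subseteq> profiles n X"
  by (subst set_Pi_pmf) (auto simp: PiE_dflt_def profiles_def)

theorem mainTheorem5:
  shows "\<exists>N :: real \<Rightarrow> nat \<Rightarrow> nat.
    \<forall>X :: 'a set. finite X \<longrightarrow>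
    (\<forall>c0. choice_function X c0 \<longrightarrow>
    (\<exists>\<nu> :: 'a rel pmf. set_pmf \<nu> \<subseteq> linear_orders X \<and>
    (\<forall>\<delta>. 0 < \<delta> \<and> \<delta> < 1 \<longrightarrow>
    (\<forall>n > N \<delta> (card X). \<forall>F.
       social_choice_function n X F \<and>
       independent_of_rejected_alternatives n X F \<and>
       pareto n X F \<and>
       neutral n X F \<and>
       weakly_anonymous n X F \<and>
       monotone_choice n X F \<longrightarrow>
       measure_pmf.prob (Pi_pmf {1..n} undefined (\<lambda>_. \<nu>))
         {\<pi>. \<forall>S\<in>nonempty_subsets X. F \<pi> S = c0 S} \<ge> \<delta>))))"
proof -
  \<comment> \<open>A union bound over at most 2^m sets leaves each of them a failure probability of
    (1 - \<delta>) / 2^m.\<close>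
  define \<delta>' where "\<delta>' \<delta> m = 1 - (1 - \<delta>) / 2 ^ m" for \<delta> :: real and m :: nat
  define v where "v \<delta> m = (1 - \<delta>' \<delta> m) / real m" for \<delta> m
  \<comment> \<open>The bound on n from \<open>sharp_threshold\<close> at level \<delta>' with
    \<epsilon> = \<open>bias m\<close>; of X only its size enters, and c0 does not.\<close>
  define N where "N \<delta> m = nat \<lceil>exp (8 * real m / (bias m * v \<delta> m)) / (v \<delta> m * (bias m)\<^sup>2)\<rceil>" for \<delta> m
  show ?thesis
  proof (intro exI[of _ N] allI impI)
    fix X :: "'a set" and c0 assume X: "finite X" and c0: "choice_function X c0"
    let ?m = "card X"
    obtain \<nu> where \<nu>: "set_pmf \<nu> \<subseteq> linear_orders X"
      and \<nu>_marginal: "\<And>T z. T \<in> nonempty_subsets X \<Longrightarrow> z \<in> T \<Longrightarrow>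
        pmf (map_pmf (\<lambda>\<pi>. rational_choice \<pi> T) \<nu>) z =
          1 / real (card T) + bias ?m * (real (card T) * of_bool (z = c0 T) - 1)"
      using exists_biased_distribution[OF X c0] by blast
    show "\<exists>\<nu> :: 'a rel pmf. set_pmf \<nu> \<subseteq> linear_orders X \<and>
      (\<forall>\<delta>. 0 < \<delta> \<and> \<delta> < 1 \<longrightarrow>
      (\<forall>n > N \<delta> ?m. \<forall>F.
       social_choice_function n X F \<and>
       independent_of_rejected_alternatives n X F \<and>
       pareto n X F \<and>
       neutral n X F \<and>
       weakly_anonymous n X F \<and>
       monotone_choice n X F \<longrightarrow>
       measure_pmf.prob (Pi_pmf {1..n} undefined (\<lambda>_. \<nu>))
         {\<pi>. \<forall>S\<in>nonempty_subsets X. F \<pi> S = c0 S} \<ge> \<delta>))"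
    proof (intro exI[of _ \<nu>] conjI allI impI \<nu>, elim conjE)
      fix \<delta> :: real and n F
      assume \<delta>: "0 < \<delta>" "\<delta> < 1" and n: "N \<delta> ?m < n"
        and F: "social_choice_function n X F" "independent_of_rejected_alternatives n X F"
          "neutral n X F" "weakly_anonymous n X F" "monotone_choice n X F"
      let ?P = "Pi_pmf {1..n} undefined (\<lambda>_. \<nu>)"
      have n': "exp (8 * real ?m / (bias ?m * v \<delta> ?m)) / (v \<delta> ?m * (bias ?m)\<^sup>2) < real n"
        using n unfolding N_def by linarith
      have \<delta>': "0 < \<delta>' \<delta> ?m" "\<delta>' \<delta> ?m < 1"
      proof -
        have "1 - \<delta> < 1 * 2 ^ ?m" using \<delta> one_le_power[of "2 :: real" ?m] by linarith
        then show "0 < \<delta>' \<delta> ?m" by (simp add: \<delta>'_def divide_simps)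
      qed (use \<delta> in \<open>simp add: \<delta>'_def\<close>)
      have prof: "\<pi> \<in> profiles n X" if "\<pi> \<in> set_pmf ?P" for \<pi>
        using set_Pi_pmf_profiles[OF \<nu>] that by blast
      have each: "\<delta>' \<delta> ?m \<le> measure_pmf.prob ?P {\<pi>. F \<pi> S = c0 S}" if S: "S \<in> nonempty_subsets X" for S
      proof (cases "2 \<le> card S")
        case True
        have SX: "S \<subseteq> X" "S \<noteq> {}" "finite S" using S X finite_subset by (auto simp: nonempty_subsets_def)
        have cS: "card S \<le> ?m" using card_mono[OF X SX(1)] .
        have s: "c0 S \<in> S" using c0 S by (simp add: choice_function_def)
        obtain R where R: "local_rule n X F S R"
          using F(2) S unfolding independent_of_rejected_alternatives_def by blast
        let ?W = "\<lambda>y. 1 / real (card S) + bias ?m * (real (card S) * of_bool (y = c0 S) - 1)"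
        let ?h = "\<lambda>\<pi>. rational_choice \<pi> S"
        have R_mono: "R (x(i := c0 S)) = c0 S"
          if "x \<in> (\<Pi>\<^sub>E i\<in>{1..n}. S)" "i \<in> {1..n}" "R x = c0 S" "x i \<noteq> c0 S" for x i
          using F(5) S R s that unfolding monotone_choice_def by blast
        have "\<delta>' \<delta> ?m \<le> expn S ?W n (\<lambda>x. of_bool (R (restrict x {1..n}) = c0 S)) (\<lambda>_. undefined)"
        proof (rule sharp_threshold[OF SX(3) True cS s _ R_mono local_rule_neutral[OF X S R F(3)]
            local_rule_weakly_anonymous[OF X S R F(4)] bias_pos _ \<delta>'])
          show "R x \<in> S" if "x \<in> (\<Pi>\<^sub>E i\<in>{1..n}. S)" for x
            using R that by (auto simp: local_rule_def)
          show "bias ?m \<le> 1 / (2 * real ?m)" using True cS by (intro bias_le) simp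
          show "exp (8 * real ?m / (bias ?m * ((1 - \<delta>' \<delta> ?m) / real ?m))) /
              ((1 - \<delta>' \<delta> ?m) / real ?m * (bias ?m)\<^sup>2) < real n"
            using n' unfolding v_def .
        qed
        also have "\<dots> = measure_pmf.prob ?P {\<pi>. R (\<lambda>i\<in>{1..n}. ?h (\<pi> i)) = c0 S}"
        proof -
          have pmf: "pmf (map_pmf ?h \<nu>) y = ?W y" if "y \<in> S" for y using \<nu>_marginal[OF S that] .
          interpret finite_distribution S ?W
          proof
            show "sum ?W S = 1"
            proof -
              have "set_pmf (map_pmf ?h \<nu>) \<subseteq> S"
                using \<nu> rational_choice_greatest[OF X _ SX(1,2)] by (auto simp: linear_orders_def subset_iff)
              then have "(\<Sum>y\<in>S. pmf (map_pmf ?h \<nu>) y) = 1" by (rule sum_pmf_eq_1[OF SX(3)])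
              then show ?thesis using pmf by simp
            qed
            show "0 \<le> ?W y" if "y \<in> S" for y using pmf[OF that, symmetric] by simp
          qed (rule SX)
          show ?thesis by (rule prob_Pi_pmf_eq_expn[OF pmf, symmetric])
        qed
        \<comment> \<open>The local rule represents F on profiles only, but these carry all the
          probability.\<close>
        also have "\<dots> = measure_pmf.prob ?P {\<pi>. F \<pi> S = c0 S}"
        proof (rule measure_pmf.finite_measure_eq_AE)
          show "AE \<pi> in ?P. (\<pi> \<in> {\<pi>. R (\<lambda>i\<in>{1..n}. ?h (\<pi> i)) = c0 S}) = (\<pi> \<in> {\<pi>. F \<pi> S = c0 S})"
            using R prof by (auto simp: AE_measure_pmf_iff local_rule_def individual_choices_def)
        qed auto
        finally show ?thesis .
      next
        \<comment> \<open>Singletons, which \<open>sharp_threshold\<close> excludes: both choices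
          are forced.\<close>
        case False
        have "S \<noteq> {}" "finite S" using S X finite_subset by (auto simp: nonempty_subsets_def)
        with False have "card S = 1" by (metis One_nat_def Suc_1 Suc_leI card_gt_0_iff le_neq_implies_less)
        then obtain s where s: "S = {s}" by (meson card_1_singletonE)
        have "F \<pi> S = c0 S" if "\<pi> \<in> profiles n X" for \<pi>
        proof -
          have "F \<pi> S \<in> S" "c0 S \<in> S"
            using F(1) c0 S that by (auto simp: social_choice_function_def choice_function_def)
          then show ?thesis using s by simp
        qed
        then have "measure_pmf.prob ?P {\<pi>. F \<pi> S = c0 S} = 1"
          using prof by (subst measure_pmf.prob_eq_1) (auto simp: AE_measure_pmf_iff)
        then show ?thesis using \<delta>' by simp
      qed
      let ?bad = "\<lambda>S. {\<pi>. F \<pi> S \<noteq> c0 S}"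
      have fin: "finite (nonempty_subsets X)" using X by (rule finite_nonempty_subsets)
      have bad: "measure_pmf.prob ?P (?bad S) \<le> (1 - \<delta>) / 2 ^ ?m" if "S \<in> nonempty_subsets X" for S
      proof -
        have "measure_pmf.prob ?P (?bad S) = 1 - measure_pmf.prob ?P {\<pi>. F \<pi> S = c0 S}"
          using measure_pmf.prob_compl[of "{\<pi>. F \<pi> S = c0 S}" ?P] by (simp add: Compl_eq_Diff_UNIV[symmetric] Collect_neg_eq)
        then show ?thesis using each[OF that] by (simp add: \<delta>'_def)
      qed
      have "measure_pmf.prob ?P (\<Union>S\<in>nonempty_subsets X. ?bad S) \<le>
          (\<Sum>S\<in>nonempty_subsets X. measure_pmf.prob ?P (?bad S))"
        using fin by (intro measure_pmf.finite_measure_subadditive_finite) auto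
      also have "\<dots> \<le> (\<Sum>S\<in>nonempty_subsets X. (1 - \<delta>) / 2 ^ ?m)" by (intro sum_mono bad)
      also have "\<dots> = real (card (nonempty_subsets X)) * ((1 - \<delta>) / 2 ^ ?m)" by simp
      also have "\<dots> \<le> 2 ^ ?m * ((1 - \<delta>) / 2 ^ ?m)"
      proof (rule mult_right_mono)
        show "real (card (nonempty_subsets X)) \<le> 2 ^ ?m"
          using of_nat_mono[OF card_nonempty_subsets_le[OF X], where 'a = real]
          by (simp only: of_nat_power of_nat_numeral)
      qed (use \<delta> in simp)
      also have "\<dots> = 1 - \<delta>" by simp
      finally have "measure_pmf.prob ?P (\<Union>S\<in>nonempty_subsets X. ?bad S) \<le> 1 - \<delta>" .
      moreover have "measure_pmf.prob ?P (- (\<Union>S\<in>nonempty_subsets X. ?bad S)) =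
          1 - measure_pmf.prob ?P (\<Union>S\<in>nonempty_subsets X. ?bad S)"
        using measure_pmf.prob_compl[of "\<Union>S\<in>nonempty_subsets X. ?bad S" ?P] by (simp add: Compl_eq_Diff_UNIV)
      moreover have "- (\<Union>S\<in>nonempty_subsets X. ?bad S) = {\<pi>. \<forall>S\<in>nonempty_subsets X. F \<pi> S = c0 S}" by auto
      ultimately show "\<delta> \<le> measure_pmf.prob ?P {\<pi>. \<forall>S\<in>nonempty_subsets X. F \<pi> S = c0 S}" by simp
    qed
  qed
qed

end
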